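(* Let $d\ge 1$ be an integer and suppose that the twin-star hypothesis $\mathcal{TS}(i)$ holds true for all $1\le i\le d$, i.e. for every $1\le i\le d$, every cycle-free $i$-partition of $K_{2i}$ is weakly equivalent to a cycle-free $i$-partition $(\Gamma_1,\dots,\Gamma_i)$ of $K_{2i}$ such that at least one of the graphs $\Gamma_j$ is isomorphic to the twin-star graph $TS_i$. Then any two cycle-free $d$-partitions of $K_{2d}$ are involution equivalent.
   Context: All graphs are simple and undirected; $(i,j)$ and $(j,i)$ denote the same edge. $K_n$ is the complete graph on $\{1,\dots,n\}$. A $d$-partition of $K_n$ is an ordered tuple $(\Gamma_1,\dots,\Gamma_d)$ of subgraphs of $K_n$, each with vertex set $\{1,\dots,n\}$, whose edge sets are pairwise disjoint and have union $E(K_n)$. It is cycle-free if no $\Gamma_i$ contains a cycle. $\mathcal{P}_d^{cf}(K_{2d})$ is the set of cycle-free $d$-partitions of $K_{2d}$. Involutions: it is known that for every $\mathcal{P}\in\mathcal{P}_d^{cf}(K_{2d})$ and distinct vertices $x,y,z$ there is a unique $\mathcal{Q}\in\mathcal{P}_d^{cf}(K_{2d})$ such that $\mathcal{P}$ and $\mathcal{Q}$ coincide (assign the edge to the component of the same index) on every edge of $K_{2d}$ other than $(x,y),(x,z),(y,z)$, and differ on at least two of these three edges. This $\mathcal{Q}$ is denoted $\mathcal{P}^{(x,y,z)}$; the map $\mathcal{P}\mapsto\mathcal{P}^{(x,y,z)}$ is an involution. Involution equivalence: $\mathcal{P},\mathcal{Q}\in\mathcal{P}_d^{cf}(K_{2d})$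 are involution equivalent if there are $n\ge 0$, $\mathcal{P}_0,\dots,\mathcal{P}_n\in\mathcal{P}_d^{cf}(K_{2d})$ and $1\le x_i<y_i<z_i\le 2d$ ($1\le i\le n$) with $\mathcal{P}_0=\mathcal{P}$, $\mathcal{P}_n=\mathcal{Q}$ and $\mathcal{P}_i^{(x_i,y_i,z_i)}=\mathcal{P}_{i-1}$ for all $1\le i\le n$. Action of $S_{2d}\times S_d$: for $\sigma\in S_{2d}$, $\sigma\circ(\Gamma_1,\dots,\Gamma_d)=(\sigma\circ\Gamma_1,\dots,\sigma\circ\Gamma_d)$ where $E(\sigma\circ\Gamma)=\{(\sigma(i),\sigma(j)):(i,j)\in E(\Gamma)\}$; for $\tau\in S_d$, $\tau\odot(\Gamma_1,\dots,\Gamma_d)=(\Gamma_{\tau^{-1}(1)},\dots,\Gamma_{\tau^{-1}(d)})$. These actions commute, and $(\sigma,\tau)\cdot\mathcal{P}=\sigma\circ(\tau\odot\mathcal{P})$. Weak equivalence: $\mathcal{P},\mathcal{Q}\in\mathcal{P}_d^{cf}(K_{2d})$ are weakly equivalent if there are $n\ge 0$, $\mathcal{P}_0,\dots,\mathcal{P}_n\in\mathcal{P}_d^{cf}(K_{2d})$, $1\le x_i<y_i<z_i\le 2d$ and $(\sigma_i,\tau_i)\in S_{2d}\times S_d$ ($1\le i\le n$) with $\mathcal{P}_0=\mathcal{P}$, $\mathcal{P}_n=\mathcal{Q}$ and $(\sigma_i,\tau_i)\cdot(\mathcal{P}_i^{(x_i,y_i,z_i)})=\mathcal{P}_{i-1}$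 for all $1\le i\le n$. The twin-star graph $TS_d$ is the tree on vertices $\{1,\dots,2d\}$ with edges $(1,2)$ and $(1,2k+1)$, $(2,2k+2)$ for $1\le k\le d-1$ (two adjacent centers, each joined to $d-1$ leaves). *)

theory Defs
  imports Main "HOL-Library.FuncSet" "HOL-Library.Disjoint_Sets" "HOL-Combinatorics.Permutations"
begin

text \<open>
  A simple undirected graph with a fixed vertex set is represented by its edge set, an edge being
  the two-element set of its end points. All graphs below have a vertex set of the form
  \<open>{1..n}\<close>, isolated vertices being allowed.
\<close>

definition complete_edges :: "nat \<Rightarrow> nat set set" where
  "complete_edges n = {{i, j} | i j. i \<in> {1..n} \<and> j \<in> {1..n} \<and> i \<noteq> j}"

definition has_cycle :: "nat set set \<Rightarrow> bool" where
  "has_cycle E \<longleftrightarrow> (\<exists>vs. length vs \<ge> 3 \<and> distinct vs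
     \<and> (\<forall>k. Suc k < length vs \<longrightarrow> {vs ! k, vs ! Suc k} \<in> E)
     \<and> {last vs, hd vs} \<in> E)"

definition graph_isomorphic :: "nat set \<Rightarrow> nat set set \<Rightarrow> nat set \<Rightarrow> nat set set \<Rightarrow> bool" where
  "graph_isomorphic V E W F \<longleftrightarrow>
     (\<exists>f. bij_betw f V W \<and> (\<forall>u\<in>V. \<forall>v\<in>V. {u, v} \<in> E \<longleftrightarrow> {f u, f v} \<in> F))"

text \<open>
  A tuple \<open>(\<Gamma>\<^sub>1, \<dots>, \<Gamma>\<^sub>d)\<close> is a function on \<open>{1..d}\<close>, extensional in the sense of
  \<open>\<rightarrow>\<^sub>E\<close>, so that equality of such functions is equality of tuples. Components may be empty
  as edge sets.
\<close>

definition partitions :: "nat \<Rightarrow> nat \<Rightarrow> (nat \<Rightarrow> nat set set) set" where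
  "partitions d n = {\<Gamma> \<in> {1..d} \<rightarrow>\<^sub>E Pow (complete_edges n).
     disjoint_family_on \<Gamma> {1..d} \<and> (\<Union>i\<in>{1..d}. \<Gamma> i) = complete_edges n}"

definition cf_partitions :: "nat \<Rightarrow> (nat \<Rightarrow> nat set set) set" where
  "cf_partitions d = {\<Gamma> \<in> partitions d (2 * d). \<forall>i\<in>{1..d}. \<not> has_cycle (\<Gamma> i)}"

definition coincide_at ::
  "nat \<Rightarrow> (nat \<Rightarrow> nat set set) \<Rightarrow> (nat \<Rightarrow> nat set set) \<Rightarrow> nat set \<Rightarrow> bool" where
  "coincide_at d P Q e \<longleftrightarrow> (\<exists>i\<in>{1..d}. e \<in> P i \<and> e \<in> Q i)"

text \<open>
  The partition \<open>P\<^sup>(\<^sup>x\<^sup>,\<^sup>y\<^sup>,\<^sup>z\<^sup>)\<close>. For a cycle-free \<open>P\<close> and distinct vertices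
  \<open>x\<close>, \<open>y\<close>, \<open>z\<close> of \<open>K\<^sub>2\<^sub>d\<close> there is exactly one such \<open>Q\<close>; the definition is
  only meaningful, and only used, in this case.
\<close>

definition involution ::
  "nat \<Rightarrow> (nat \<Rightarrow> nat set set) \<Rightarrow> nat \<Rightarrow> nat \<Rightarrow> nat \<Rightarrow> (nat \<Rightarrow> nat set set)" where
  "involution d P x y z = (THE Q. Q \<in> cf_partitions d
     \<and> (\<forall>e \<in> complete_edges (2 * d) - {{x, y}, {x, z}, {y, z}}. coincide_at d P Q e)
     \<and> card {e \<in> {{x, y}, {x, z}, {y, z}}. \<not> coincide_at d P Q e} \<ge> 2)"

definition involution_equivalent ::
  "nat \<Rightarrow> (nat \<Rightarrow> nat set set) \<Rightarrow> (nat \<Rightarrow> nat set set) \<Rightarrow> bool" where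
  "involution_equivalent d P Q \<longleftrightarrow>
     (\<exists>(n::nat) R x y z. R 0 = P \<and> R n = Q \<and> (\<forall>i\<in>{0..n}. R i \<in> cf_partitions d)
       \<and> (\<forall>i\<in>{1..n}. 1 \<le> x i \<and> x i < y i \<and> y i < z i \<and> z i \<le> 2 * d
            \<and> involution d (R i) (x i) (y i) (z i) = R (i - 1)))"

definition vertex_act ::
  "nat \<Rightarrow> (nat \<Rightarrow> nat) \<Rightarrow> (nat \<Rightarrow> nat set set) \<Rightarrow> (nat \<Rightarrow> nat set set)" where
  "vertex_act d \<sigma> \<Gamma> = (\<lambda>i\<in>{1..d}. {{\<sigma> u, \<sigma> v} | u v. {u, v} \<in> \<Gamma> i})"

definition index_act ::
  "nat \<Rightarrow> (nat \<Rightarrow> nat) \<Rightarrow> (nat \<Rightarrow> nat set set) \<Rightarrow> (nat \<Rightarrow> nat set set)" where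
  "index_act d \<tau> \<Gamma> = (\<lambda>i\<in>{1..d}. \<Gamma> (inv \<tau> i))"

definition weakly_equivalent ::
  "nat \<Rightarrow> (nat \<Rightarrow> nat set set) \<Rightarrow> (nat \<Rightarrow> nat set set) \<Rightarrow> bool" where
  "weakly_equivalent d P Q \<longleftrightarrow>
     (\<exists>(n::nat) R x y z \<sigma> \<tau>. R 0 = P \<and> R n = Q \<and> (\<forall>i\<in>{0..n}. R i \<in> cf_partitions d)
       \<and> (\<forall>i\<in>{1..n}. 1 \<le> x i \<and> x i < y i \<and> y i < z i \<and> z i \<le> 2 * d
            \<and> \<sigma> i permutes {1..2 * d} \<and> \<tau> i permutes {1..d}
            \<and> vertex_act d (\<sigma> i) (index_act d (\<tau> i) (involution d (R i) (x i) (y i) (z i)))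
                = R (i - 1)))"

definition twin_star :: "nat \<Rightarrow> nat set set" where
  "twin_star d = {{1, 2}} \<union> {{1, 2 * k + 1} | k. k \<in> {1..d - 1}}
     \<union> {{2, 2 * k + 2} | k. k \<in> {1..d - 1}}"

definition twin_star_hypothesis :: "nat \<Rightarrow> bool" where
  "twin_star_hypothesis d \<longleftrightarrow>
     (\<forall>P \<in> cf_partitions d. \<exists>\<Gamma> \<in> cf_partitions d. weakly_equivalent d P \<Gamma>
        \<and> (\<exists>j\<in>{1..d}. graph_isomorphic {1..2 * d} (\<Gamma> j) {1..2 * d} (twin_star d)))"

end

theory Submission
  imports Defs
begin

text \<open>
  Vertices and colours are allowed to range over arbitrary finite sets \<open>V\<close>, \<open>C\<close> with
  \<open>card V = 2 * card C\<close>; a partition becomes a colouring of the edges whose classes are forests,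
  hence spanning trees. By the twin-star hypothesis it suffices to connect colourings having a
  twin-star class \<open>j\<close>, with centres \<open>a\<close>, \<open>b\<close>. In all other classes \<open>a\<close> and \<open>b\<close> are leaves, so
  deleting them leaves a cycle-free colouring of \<open>V - {a, b}\<close> by \<open>C - {j}\<close>, which can be changed
  at will by induction. A triangle \<open>a v v'\<close> with two leaves at \<open>b\<close> swaps the colours of \<open>av\<close> and
  \<open>av'\<close>, and the triangles \<open>abu\<close>, \<open>abv\<close>, \<open>abu\<close> exchange a leaf \<open>u\<close> of \<open>a\<close> with a leaf \<open>v\<close> of \<open>b\<close>;
  hence all colourings with given \<open>j\<close>, \<open>a\<close>, \<open>b\<close> are connected. Since the inner colouring can be
  chosen with a twin star that \<open>a\<close> and \<open>b\<close> extend to a twin star of \<open>V\<close>, the pair \<open>(j, {a, b})\<close>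
  is connected with every \<open>(i, {x, y})\<close> such that \<open>i \<noteq> j\<close> and \<open>{x, y}\<close> is disjoint from
  \<open>{a, b}\<close>. For three or more colours these moves suffice; for two colours the triangle \<open>abu\<close>
  turns the path with centres \<open>a\<close>, \<open>b\<close> into one with centres \<open>u\<close>, \<open>b\<close>.
\<close>

section \<open>Forests\<close>

definition edges :: "'v set \<Rightarrow> 'v set set" where
  "edges V = {e. e \<subseteq> V \<and> card e = 2}"

definition conn :: "'v set set \<Rightarrow> ('v \<times> 'v) set" where
  "conn E = {(u, v). {u, v} \<in> E}\<^sup>*"

text \<open>Acyclicity in bridge form, which turns it into statements about \<open>conn\<close>
  alone; \<open>has_cycle_iff_not_forest\<close> relates it to cycles given as vertex lists. A loop
  violates it, because \<open>(x, x)\<close> always lies in \<open>conn\<close>.\<close>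

definition forest :: "'v set set \<Rightarrow> bool" where
  "forest E \<longleftrightarrow> (\<forall>x y. {x, y} \<in> E \<longrightarrow> (x, y) \<notin> conn (E - {{x, y}}))"

lemma doubleton_in_edges [simp]: "{x, y} \<in> edges V \<longleftrightarrow> x \<in> V \<and> y \<in> V \<and> x \<noteq> y"
  by (auto simp: edges_def card_2_iff doubleton_eq_iff)

lemma edgesE:
  assumes "e \<in> edges V"
  obtains x y where "e = {x, y}" "x \<in> V" "y \<in> V" "x \<noteq> y"
  using assms by (auto simp: edges_def card_2_iff)

lemma edges_mono: "V \<subseteq> W \<Longrightarrow> edges V \<subseteq> edges W"
  by (auto simp: edges_def)

lemma finite_edges: "finite V \<Longrightarrow> finite (edges V)"
  by (simp add: edges_def)

lemma card_edges: "finite V \<Longrightarrow> card (edges V) = card V choose 2"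
  by (simp add: edges_def n_subsets)

lemma complete_edges_eq: "complete_edges n = edges {1..n}"
  unfolding complete_edges_def edges_def card_2_iff by fastforce

lemma conn_refl [simp]: "(x, x) \<in> conn E"
  by (simp add: conn_def)

lemma conn_sym: "(x, y) \<in> conn E \<Longrightarrow> (y, x) \<in> conn E"
  unfolding conn_def by (rule symD[OF sym_rtrancl]) (auto simp: sym_def insert_commute)

lemma conn_trans: "(x, y) \<in> conn E \<Longrightarrow> (y, z) \<in> conn E \<Longrightarrow> (x, z) \<in> conn E"
  by (auto simp: conn_def)

lemma conn_edge: "{x, y} \<in> E \<Longrightarrow> (x, y) \<in> conn E"
  by (auto simp: conn_def)

lemma conn_mono: "(x, y) \<in> conn E \<Longrightarrow> E \<subseteq> F \<Longrightarrow> (x, y) \<in> conn F"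
  unfolding conn_def by (rule subsetD[OF rtrancl_mono]) auto

text \<open>A walk can be shortened until it crosses the new edge at most once, in one of two
  directions. Connectivity after an insertion thus becomes a Boolean combination of old
  connectivities, so that \<open>forest_triangle_iff\<close> can be settled by cases.\<close>

lemma conn_insert:
  "(u, v) \<in> conn (insert {x, y} E) \<longleftrightarrow> (u, v) \<in> conn E
     \<or> (u, x) \<in> conn E \<and> (y, v) \<in> conn E \<or> (u, y) \<in> conn E \<and> (x, v) \<in> conn E"
  (is "?L \<longleftrightarrow> ?R v")
proof
  assume ?L
  then show "?R v"
    unfolding conn_def[of "insert _ _"]
  proof (induction rule: rtrancl_induct)
    case base
    then show ?case by simp
  next
    case (step v w)
    consider "v = x" "w = y" | "v = y" "w = x" | "{v, w} \<in> E"
      using step.hyps by (auto simp: doubleton_eq_iff)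
    then show ?case
    proof cases
      case 3
      then have "(v, w) \<in> conn E" by (rule conn_edge)
      then show ?thesis using step.IH conn_trans by metis
    qed (use step.IH conn_sym conn_trans conn_refl in metis)+
  qed
next
  assume "?R v"
  moreover have "(x, y) \<in> conn (insert {x, y} E)"
    by (simp add: conn_edge)
  ultimately show ?L
    by (meson conn_mono conn_sym conn_trans subset_insertI)
qed

lemma conn_isolated:
  assumes "(x, y) \<in> conn E" "x \<notin> \<Union>E"
  shows "y = x"
  using assms unfolding conn_def by (induction rule: rtrancl_induct) auto

lemma conn_leaves_vertex:
  assumes "(x, y) \<in> conn E" "x \<noteq> y"
  obtains w where "{x, w} \<in> E"
  using assms unfolding conn_def by (induction rule: converse_rtrancl_induct) auto

lemma forest_empty [simp]: "forest {}"
  by (simp add: forest_def)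

lemma forest_subset: "forest F \<Longrightarrow> E \<subseteq> F \<Longrightarrow> forest E"
  unfolding forest_def by (meson Diff_mono conn_mono subset_refl subsetD)

text \<open>For the backward direction: if an older edge \<open>{u, v}\<close> ceases to be a
  bridge, then by \<open>conn_insert\<close> the detour from \<open>u\<close> to \<open>v\<close>
  runs through \<open>{x, y}\<close>, and together with \<open>{u, v}\<close> it joins
  \<open>x\<close> to \<open>y\<close> within \<open>E\<close>.\<close>

lemma forest_insert:
  assumes "{x, y} \<notin> E"
  shows "forest (insert {x, y} E) \<longleftrightarrow> forest E \<and> (x, y) \<notin> conn E"
proof
  assume "forest (insert {x, y} E)"
  then show "forest E \<and> (x, y) \<notin> conn E"
    using assms forest_subset[of "insert {x, y} E" E]
    by (auto simp: forest_def Diff_insert_absorb)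
next
  assume E: "forest E \<and> (x, y) \<notin> conn E"
  show "forest (insert {x, y} E)"
    unfolding forest_def
  proof (intro allI impI notI)
    fix u v
    assume uv: "{u, v} \<in> insert {x, y} E" and c: "(u, v) \<in> conn (insert {x, y} E - {{u, v}})"
    show False
    proof (cases "{u, v} = {x, y}")
      case True
      then show False
        using E c assms by (auto simp: doubleton_eq_iff insert_commute dest: conn_sym)
    next
      case False
      then have eq: "insert {x, y} E - {{u, v}} = insert {x, y} (E - {{u, v}})" and uvE: "{u, v} \<in> E"
        using uv by auto
      have "(u, v) \<notin> conn (E - {{u, v}})"
        using E uvE by (auto simp: forest_def)
      then have "(u, x) \<in> conn (E - {{u, v}}) \<and> (y, v) \<in> conn (E - {{u, v}})
          \<or> (u, y) \<in> conn (E - {{u, v}}) \<and> (x, v) \<in> conn (E - {{u, v}})"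
        using c unfolding eq conn_insert by blast
      then have "(u, x) \<in> conn E \<and> (y, v) \<in> conn E \<or> (u, y) \<in> conn E \<and> (x, v) \<in> conn E"
        by (meson Diff_subset conn_mono)
      then have "(x, y) \<in> conn E"
        using conn_edge[OF uvE] by (meson conn_sym conn_trans)
      then show False using E by simp
    qed
  qed
qed

lemma forest_insert_leaf:
  assumes "forest E" "x \<notin> \<Union>E" "x \<noteq> y"
  shows "forest (insert {x, y} E)"
  using assms conn_isolated[of x y E] by (subst forest_insert) auto

text \<open>Once \<open>{a, b}\<close> is removed, \<open>u\<close> stays on the side of
  \<open>a\<close>, so \<open>{b, u}\<close> joins two different components. Only an upper bound on
  \<open>E'\<close> is asked for, so that a colour class need not be computed exactly.\<close>

lemma forest_exchange:
  assumes "forest E" "{a, b} \<in> E" "{a, u} \<in> E" "b \<noteq> u" "E' \<subseteq> insert {b, u} (E - {{a, b}})"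
  shows "forest E'"
proof -
  have "{a, u} \<in> E - {{a, b}}"
    using assms by (auto simp: doubleton_eq_iff)
  moreover have nc: "(a, b) \<notin> conn (E - {{a, b}})"
    using assms by (auto simp: forest_def)
  ultimately have "(b, u) \<notin> conn (E - {{a, b}})"
    by (meson conn_edge conn_sym conn_trans)
  then have "forest (insert {b, u} (E - {{a, b}}))"
    using assms(1) conn_edge forest_subset forest_insert by (metis Diff_subset)
  then show ?thesis
    using assms(5) forest_subset by blast
qed

section \<open>Counting the edges of a forest\<close>

text \<open>The fibres of \<open>r\<close> are the components, and each inserted edge merges two of
  them, so components and edges together always number as many as the vertices.\<close>

lemma forest_labelling:
  fixes V :: "'v set"
  assumes "finite E" "E \<subseteq> edges V" "finite V" "forest E"
  shows "\<exists>r :: 'v \<Rightarrow> 'v. (\<forall>u\<in>V. \<forall>v\<in>V. r u = r v \<longleftrightarrow> (u, v) \<in> conn E) \<and> card (r ` V) + card E = card V"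
  using assms
proof (induction E rule: finite_induct)
  case empty
  have "(u, v) \<in> conn {} \<longleftrightarrow> u = v" for u v :: 'v
    using conn_isolated[of u v "{}"] by auto
  then show ?case by (intro exI[of _ id]) auto
next
  case (insert e E)
  then obtain x y where e: "e = {x, y}" and xy: "x \<in> V" "y \<in> V"
    by (auto elim: edgesE)
  have nc: "(x, y) \<notin> conn E" and "forest E"
    using insert e by (auto simp: forest_insert)
  then obtain r :: "'v \<Rightarrow> 'v"
    where "\<forall>u\<in>V. \<forall>v\<in>V. r u = r v \<longleftrightarrow> (u, v) \<in> conn E" and card: "card (r ` V) + card E = card V"
    using insert.IH insert.prems(1,2) by auto
  then have r: "r u = r v \<longleftrightarrow> (u, v) \<in> conn E" if "u \<in> V" "v \<in> V" for u v
    using that by simp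
  have ne: "r x \<noteq> r y" using nc r xy by blast
  \<comment> \<open>The component of \<open>x\<close> takes over the label of the component of
    \<open>y\<close>, so that exactly the label \<open>r x\<close> disappears.\<close>
  define r' where "r' u = (if r u = r x then r y else r u)" for u
  have r': "r' u = r' v \<longleftrightarrow> (u, v) \<in> conn (insert e E)" if "u \<in> V" "v \<in> V" for u v
    using that xy by (auto simp: r'_def e conn_insert r[symmetric])
  have "r' ` V = r ` V - {r x}"
  proof
    show "r' ` V \<subseteq> r ` V - {r x}" using ne xy by (auto simp: r'_def)
    show "r ` V - {r x} \<subseteq> r' ` V"
    proof
      fix z assume "z \<in> r ` V - {r x}"
      then obtain u where "u \<in> V" "z = r u" "r u \<noteq> r x" by auto
      then show "z \<in> r' ` V" by (intro image_eqI[of _ _ u]) (auto simp: r'_def)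
    qed
  qed
  then have "card (r' ` V) + 1 = card (r ` V)"
    using xy insert.prems(2) card_Suc_Diff1[of "r ` V" "r x"] by simp
  then have "card (r' ` V) + card (insert e E) = card V"
    using card insert.hyps by simp
  with r' show ?case by (intro exI[of _ r']) auto
qed

lemma forest_card_le:
  assumes "E \<subseteq> edges V" "finite V" "V \<noteq> {}" "forest E"
  shows "card E \<le> card V - 1"
proof -
  have "finite E"
    using assms finite_edges finite_subset by blast
  then obtain r :: "'a \<Rightarrow> 'a" where "card (r ` V) + card E = card V"
    using forest_labelling[OF _ assms(1,2,4)] by auto
  moreover have "card (r ` V) > 0"
    using assms by (simp add: card_gt_0_iff)
  ultimately show ?thesis by simp
qed

section \<open>Forests and cycles as vertex lists\<close>

text \<open>When a walk returns to a visited vertex \<open>z\<close>, the list is cut back to its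
  occurrence of \<open>z\<close>. Distinctness is what \<open>has_cycle\<close> demands.\<close>

lemma conn_simple_path:
  assumes "(x, y) \<in> conn E"
  shows "\<exists>vs. vs \<noteq> [] \<and> hd vs = x \<and> last vs = y \<and> distinct vs
           \<and> successively (\<lambda>u v. {u, v} \<in> E) vs"
  using assms unfolding conn_def
proof (induction rule: rtrancl_induct)
  case base
  show ?case by (rule exI[of _ "[x]"]) simp
next
  case (step y z)
  then obtain vs where vs: "vs \<noteq> []" "hd vs = x" "last vs = y" "distinct vs"
    "successively (\<lambda>u v. {u, v} \<in> E) vs" by blast
  show ?case
  proof (cases "z \<in> set vs")
    case True
    then obtain ps qs where eq: "vs = (ps @ [z]) @ qs" by (metis append.assoc append_Cons append_Nil split_list)
    have "successively (\<lambda>u v. {u, v} \<in> E) (ps @ [z])"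
      using vs(5) unfolding eq successively_append_iff by blast
    moreover have "hd (ps @ [z]) = x"
      using vs(2) unfolding eq by (cases ps) auto
    ultimately show ?thesis
      using vs(4) unfolding eq by (intro exI[of _ "ps @ [z]"]) auto
  next
    case False
    with vs step.hyps show ?thesis
      by (intro exI[of _ "vs @ [z]"]) (auto simp: successively_append_iff)
  qed
qed

lemma successively_conn:
  assumes "successively (\<lambda>u v. {u, v} \<in> E) vs" "vs \<noteq> []"
  shows "(hd vs, last vs) \<in> conn E"
  using assms
proof (induction vs)
  case (Cons v vs)
  then show ?case by (cases vs) (auto intro: conn_trans conn_edge)
qed simp

text \<open>The closing edge of a cycle is no bridge, because the rest of the list avoids it;
  conversely, the ends of an edge that is no bridge are joined by a simple path avoiding it, which
  has at least three vertices. The inclusion in \<open>edges V\<close> rules out loops, which would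
  violate \<open>forest\<close> without giving a cycle.\<close>

lemma has_cycle_iff_not_forest:
  assumes "E \<subseteq> edges V"
  shows "has_cycle E \<longleftrightarrow> \<not> forest E"
proof
  assume "has_cycle E"
  then obtain vs where vs: "length vs \<ge> 3" "distinct vs"
    "\<And>k. Suc k < length vs \<Longrightarrow> {vs ! k, vs ! Suc k} \<in> E" "{last vs, hd vs} \<in> E"
    unfolding has_cycle_def by blast
  define n where "n = length vs"
  have ends: "hd vs = vs ! 0" "last vs = vs ! (n - 1)"
    using vs by (cases vs; auto simp: hd_conv_nth last_conv_nth n_def)+
  \<comment> \<open>No consecutive pair is the closing edge; this is where length at least 3
    enters.\<close>
  have "{vs ! k, vs ! Suc k} \<noteq> {hd vs, last vs}" if "Suc k < n" for k
  proof -
    have "vs ! k = vs ! l \<longleftrightarrow> k = l" "vs ! Suc k = vs ! l \<longleftrightarrow> Suc k = l" if "l < n" for l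
      using that \<open>Suc k < n\<close> vs(2) nth_eq_iff_index_eq n_def by (metis Suc_lessD)+
    moreover have "0 < n" "n - 1 < n" "n \<ge> 3" using vs(1) n_def by auto
    ultimately show ?thesis
      using \<open>Suc k < n\<close> unfolding ends doubleton_eq_iff by (simp; arith)
  qed
  then have "successively (\<lambda>u v. {u, v} \<in> E - {{hd vs, last vs}}) vs"
    using vs by (auto simp: successively_conv_nth n_def)
  then have "(hd vs, last vs) \<in> conn (E - {{hd vs, last vs}})"
    using vs by (intro successively_conn) auto
  then show "\<not> forest E"
    using vs unfolding forest_def by (metis insert_commute)
next
  assume "\<not> forest E"
  then obtain x y where xy: "{x, y} \<in> E" "(x, y) \<in> conn (E - {{x, y}})"
    by (auto simp: forest_def)
  then obtain vs where vs: "vs \<noteq> []" "hd vs = x" "last vs = y" "distinct vs"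
    "successively (\<lambda>u v. {u, v} \<in> E - {{x, y}}) vs"
    using conn_simple_path by metis
  have "x \<noteq> y" using xy assms by (metis doubleton_in_edges subsetD)
  have "length vs \<noteq> 1" using vs \<open>x \<noteq> y\<close> by (cases vs) auto
  moreover have "length vs \<noteq> 2"
    using vs by (auto simp: length_Suc_conv numeral_2_eq_2)
  moreover have "length vs \<noteq> 0" using vs by simp
  ultimately have "length vs \<ge> 3" by linarith
  then show "has_cycle E"
    unfolding has_cycle_def using vs xy
    by (intro exI[of _ vs]) (auto simp: successively_conv_nth insert_commute)
qed

section \<open>Cycle-free colourings and triangles\<close>

definition colour_class :: "'v set \<Rightarrow> ('v set \<Rightarrow> 'c) \<Rightarrow> 'c \<Rightarrow> 'v set set" where
  "colour_class V c i = {e \<in> edges V. c e = i}"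

text \<open>Values of \<open>c\<close> outside \<open>edges V\<close> are left arbitrary. The
  cardinality condition makes the edge count tight, so that the forests are spanning trees
  (\<open>cf_colouring_connected\<close>).\<close>

definition cf_colouring :: "'v set \<Rightarrow> 'c set \<Rightarrow> ('v set \<Rightarrow> 'c) \<Rightarrow> bool" where
  "cf_colouring V C c \<longleftrightarrow> finite V \<and> finite C \<and> card V = 2 * card C \<and> c \<in> edges V \<rightarrow> C
     \<and> (\<forall>i\<in>C. forest (colour_class V c i))"

lemma in_colour_class [simp]: "e \<in> colour_class V c i \<longleftrightarrow> e \<in> edges V \<and> c e = i"
  by (simp add: colour_class_def)

lemma colour_class_subset: "colour_class V c i \<subseteq> edges V"
  by auto

lemma cf_colouringD:
  assumes "cf_colouring V C c"
  shows "finite V" "finite C" "card V = 2 * card C" "\<And>e. e \<in> edges V \<Longrightarrow> c e \<in> C"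
    "\<And>i. i \<in> C \<Longrightarrow> forest (colour_class V c i)"
  using assms by (auto simp: cf_colouring_def)

lemma cf_colouring_cong:
  assumes "cf_colouring V C c" "\<And>e. e \<in> edges V \<Longrightarrow> c' e = c e"
  shows "cf_colouring V C c'"
proof -
  have "colour_class V c' i = colour_class V c i" for i
    using assms(2) by auto
  then show ?thesis using assms by (simp add: cf_colouring_def Pi_iff)
qed

text \<open>With \<open>n\<close> colours there are \<open>2 * n\<close> vertices; each of the
  \<open>n\<close> forests has at most \<open>2 * n - 1\<close> edges, while all edges together
  number \<open>n * (2 * n - 1)\<close>. Hence no class falls below the bound.\<close>

lemma cf_colouring_class_card:
  assumes c: "cf_colouring V C c" and i: "i \<in> C"
  shows "card (colour_class V c i) = 2 * card C - 1"
proof (rule ccontr)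
  note D = cf_colouringD[OF c]
  have C: "card C > 0" using i D(2) card_gt_0_iff by blast
  then have "V \<noteq> {}" using D(3) by force
  have fin: "finite (colour_class V c k)" for k
    using finite_edges[OF D(1)] by (simp add: colour_class_def)
  have le: "card (colour_class V c k) \<le> 2 * card C - 1" if "k \<in> C" for k
    using forest_card_le[OF colour_class_subset D(1) \<open>V \<noteq> {}\<close> D(5)[OF that]] D(3) by simp
  assume "card (colour_class V c i) \<noteq> 2 * card C - 1"
  then have "card (colour_class V c i) < 2 * card C - 1"
    using le[OF i] by simp
  then have "(\<Sum>k\<in>C. card (colour_class V c k)) < (\<Sum>k\<in>C. 2 * card C - 1)"
    using le by (intro sum_strict_mono_ex1[OF D(2)] ballI bexI[OF _ i])
  moreover have "(\<Sum>k\<in>C. card (colour_class V c k)) = card (\<Union>k\<in>C. colour_class V c k)"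
    using D(2) fin by (subst card_UN_disjoint) auto
  moreover have "(\<Union>k\<in>C. colour_class V c k) = edges V"
    using D(4) by (auto simp: colour_class_def)
  ultimately have "card V choose 2 < card C * (2 * card C - 1)"
    using D(1) by (simp add: card_edges)
  then show False
    by (simp add: D(3) choose_two)
qed

text \<open>Otherwise \<open>{u, v}\<close> could be added to class \<open>i\<close>, giving a
  forest with as many edges as vertices.\<close>

lemma cf_colouring_connected:
  assumes c: "cf_colouring V C c" and i: "i \<in> C" and uv: "u \<in> V" "v \<in> V"
  shows "(u, v) \<in> conn (colour_class V c i)"
proof (rule ccontr)
  assume nc: "(u, v) \<notin> conn (colour_class V c i)"
  note D = cf_colouringD[OF c]
  have "u \<noteq> v" using nc by auto
  have new: "{u, v} \<notin> colour_class V c i" using nc conn_edge by metis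
  then have "forest (insert {u, v} (colour_class V c i))"
    using nc D(5)[OF i] by (simp only: forest_insert[OF new] simp_thms)
  moreover have "insert {u, v} (colour_class V c i) \<subseteq> edges V"
    using uv \<open>u \<noteq> v\<close> by (auto simp: colour_class_def)
  ultimately have "card (insert {u, v} (colour_class V c i)) \<le> card V - 1"
    using D(1) uv(1) forest_card_le by blast
  moreover have "finite (colour_class V c i)"
    using finite_edges[OF D(1)] by (simp add: colour_class_def)
  moreover have "card C > 0" using i D(2) card_gt_0_iff by blast
  ultimately show False
    using new cf_colouring_class_card[OF c i] D(3) by simp
qed

lemma cf_colouring_forestI:
  assumes "cf_colouring V C c" "i \<in> C" "E \<subseteq> colour_class V c i"
  shows "forest E"
  using forest_subset[OF cf_colouringD(5)[OF assms(1,2)] assms(3)] .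

section \<open>Recolouring a single triangle\<close>

text \<open>Here \<open>X\<close>, \<open>Y\<close>, \<open>Z\<close> say which of the edges \<open>xy\<close>, \<open>xz\<close>, \<open>yz\<close> of a triangle join vertices
  of the same component of a forest \<open>F\<close>, and \<open>p\<close>, \<open>q\<close>, \<open>r\<close> which of these edges are added to \<open>F\<close>.\<close>

definition triangle_compat :: "bool \<Rightarrow> bool \<Rightarrow> bool \<Rightarrow> bool \<Rightarrow> bool \<Rightarrow> bool \<Rightarrow> bool" where
  "triangle_compat X Y Z p q r \<longleftrightarrow> \<not> (p \<and> q \<and> r)
     \<and> (p \<and> \<not> q \<and> \<not> r \<longrightarrow> \<not> X \<and> Y \<noteq> Z) \<and> (\<not> p \<and> q \<and> \<not> r \<longrightarrow> \<not> Y \<and> X \<noteq> Z)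
     \<and> (\<not> p \<and> \<not> q \<and> r \<longrightarrow> \<not> Z \<and> X \<noteq> Y)
     \<and> (p \<and> q \<or> p \<and> r \<or> q \<and> r \<longrightarrow> \<not> X \<and> \<not> Y \<and> \<not> Z)
     \<and> (\<not> p \<and> \<not> q \<and> \<not> r \<longrightarrow> X \<and> Y \<and> Z)"

text \<open>Contracting the components of \<open>F\<close> leaves one, two or three points for
  \<open>x\<close>, \<open>y\<close>, \<open>z\<close>, and the added edges have to form a tree on
  them; \<open>triangle_compat\<close> spells this out for all choices of added edges.\<close>

lemma forest_triangle_iff:
  assumes F: "forest F" "{x, y} \<notin> F" "{x, z} \<notin> F" "{y, z} \<notin> F" and ne: "x \<noteq> y" "x \<noteq> z" "y \<noteq> z"
    and E: "E = F \<union> (if p then {{x, y}} else {}) \<union> (if q then {{x, z}} else {})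
      \<union> (if r then {{y, z}} else {})"
  shows "forest E \<and> (x, y) \<in> conn E \<and> (x, z) \<in> conn E
     \<longleftrightarrow> triangle_compat ((x, y) \<in> conn F) ((x, z) \<in> conn F) ((y, z) \<in> conn F) p q r"
proof -
  have sym: "(y, x) \<in> conn F \<longleftrightarrow> (x, y) \<in> conn F" "(z, x) \<in> conn F \<longleftrightarrow> (x, z) \<in> conn F"
    "(z, y) \<in> conn F \<longleftrightarrow> (y, z) \<in> conn F"
    using conn_sym by metis+
  have trans: "(x, y) \<in> conn F \<Longrightarrow> (y, z) \<in> conn F \<Longrightarrow> (x, z) \<in> conn F"
    "(x, y) \<in> conn F \<Longrightarrow> (x, z) \<in> conn F \<Longrightarrow> (y, z) \<in> conn F"
    "(x, z) \<in> conn F \<Longrightarrow> (y, z) \<in> conn F \<Longrightarrow> (x, y) \<in> conn F"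
    using conn_trans sym by metis+
  have dis: "{x, y} \<noteq> {x, z}" "{x, y} \<noteq> {y, z}" "{x, z} \<noteq> {y, z}"
    using ne by (auto simp: doubleton_eq_iff)
  show ?thesis
    unfolding E
    by (cases p; cases q; cases r)
      (use F dis trans in \<open>auto simp: forest_insert conn_insert sym triangle_compat_def\<close>)
qed

text \<open>A colour absent from the triangle already connects all three corners and can take none
  of its edges, so only \<open>p\<close>, \<open>q\<close>, \<open>r\<close> can be redistributed.
  This is the combinatorial core of existence and uniqueness of the involution.\<close>

lemma triangle_compat_other_colours:
  assumes "p \<in> C" "q \<in> C" "r \<in> C" "\<And>i. i \<in> C \<Longrightarrow> triangle_compat (X i) (Y i) (Z i) (p = i) (q = i) (r = i)"
  shows "\<exists>p' q' r'. {p', q', r'} \<subseteq> C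
    \<and> (\<forall>i\<in>C. triangle_compat (X i) (Y i) (Z i) (p' = i) (q' = i) (r' = i))
    \<and> (p \<noteq> p' \<and> q \<noteq> q' \<or> p \<noteq> p' \<and> r \<noteq> r' \<or> q \<noteq> q' \<and> r \<noteq> r')
    \<and> (\<forall>s\<in>C. \<forall>t\<in>C. \<forall>u\<in>C. (\<forall>i\<in>C. triangle_compat (X i) (Y i) (Z i) (s = i) (t = i) (u = i))
         \<longrightarrow> (s, t, u) = (p, q, r) \<or> (s, t, u) = (p', q', r'))"
    (is "\<exists>p' q' r'. ?P p' q' r'")
proof -
  note c = assms(4)[OF assms(1)] assms(4)[OF assms(2)] assms(4)[OF assms(3)]
  \<comment> \<open>Reduces the claim to a rearrangement of \<open>p\<close>, \<open>q\<close>,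
    \<open>r\<close> and to the compatibility conditions of these three colours.\<close>
  have witness: ?thesis if w1: "{p', q', r'} = {p, q, r}" and w2:
    "\<And>i. i \<in> {p, q, r} \<Longrightarrow> triangle_compat (X i) (Y i) (Z i) (p' = i) (q' = i) (r' = i)"
    and w3: "p \<noteq> p' \<and> q \<noteq> q' \<or> p \<noteq> p' \<and> r \<noteq> r' \<or> q \<noteq> q' \<and> r \<noteq> r'"
    and w4: "\<And>s t u. s \<in> {p, q, r} \<Longrightarrow> t \<in> {p, q, r} \<Longrightarrow> u \<in> {p, q, r}
      \<Longrightarrow> triangle_compat (X p) (Y p) (Z p) (s = p) (t = p) (u = p)
      \<Longrightarrow> triangle_compat (X q) (Y q) (Z q) (s = q) (t = q) (u = q)
      \<Longrightarrow> triangle_compat (X r) (Y r) (Z r) (s = r) (t = r) (u = r)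
      \<Longrightarrow> (s, t, u) = (p, q, r) \<or> (s, t, u) = (p', q', r')" for p' q' r'
  proof -
    have "triangle_compat (X i) (Y i) (Z i) (p' = i) (q' = i) (r' = i)" if "i \<in> C" for i
    proof (cases "i \<in> {p, q, r}")
      case False
      moreover from this w1 have "i \<notin> {p', q', r'}" by simp
      ultimately show ?thesis using assms(4)[OF \<open>i \<in> C\<close>] by (simp add: eq_commute[of _ i])
    qed (use w2 in blast)
    moreover have "{p', q', r'} \<subseteq> C" using assms(1-3) w1 by auto
    moreover have "(s, t, u) = (p, q, r) \<or> (s, t, u) = (p', q', r')"
      if "s \<in> C" "t \<in> C" "u \<in> C"
        and stu: "\<And>i. i \<in> C \<Longrightarrow> triangle_compat (X i) (Y i) (Z i) (s = i) (t = i) (u = i)" for s t u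
    proof (rule w4)
      have "k \<in> {p, q, r}" if "k \<in> C" "k \<in> {s, t, u}" for k
      proof (rule ccontr)
        assume "k \<notin> {p, q, r}"
        then have "X k \<and> Y k \<and> Z k"
          using assms(4)[OF that(1)] by (auto simp: triangle_compat_def)
        then show False
          using stu[OF that(1)] that(2) by (auto simp: triangle_compat_def)
      qed
      then show "s \<in> {p, q, r}" "t \<in> {p, q, r}" "u \<in> {p, q, r}"
        using that(1-3) by simp_all
    qed (use stu assms(1-3) in simp_all)
    ultimately show ?thesis
      using w3 by (intro exI[of _ p'] exI[of _ q'] exI[of _ r']) simp
  qed
  \<comment> \<open>All colours equal is impossible. If exactly two agree, the third moves to the
    one other edge it can occupy. If all differ, each has exactly one alternative edge; a map
    without fixed points on three edges has exactly one cycle, and shifting colours along it, by a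
    transposition (three cases) or a rotation (two cases), gives the other solution.\<close>
  consider "p = q" "q = r" | "p = q" "q \<noteq> r" "X r" | "p = q" "q \<noteq> r" "Y r"
    | "p = r" "q \<noteq> r" "X q" | "p = r" "q \<noteq> r" "Z q" | "q = r" "p \<noteq> q" "Y p" | "q = r" "p \<noteq> q" "Z p"
    | "p \<noteq> q" "q \<noteq> r" "p \<noteq> r" "Z p" "Z q" | "p \<noteq> q" "q \<noteq> r" "p \<noteq> r" "Y p" "Y r"
    | "p \<noteq> q" "q \<noteq> r" "p \<noteq> r" "X q" "X r" | "p \<noteq> q" "q \<noteq> r" "p \<noteq> r" "Z q" "X r" "Y p"
    | "p \<noteq> q" "q \<noteq> r" "p \<noteq> r" "Y r" "Z p" "X q"
    using c unfolding triangle_compat_def by metis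
  then show ?thesis
  proof cases
    case 1
    then show ?thesis using c by (simp add: triangle_compat_def)
  next
    case 2
    with c show ?thesis by (intro witness[of p r p]) (auto simp: triangle_compat_def)
  next
    case 3
    with c show ?thesis by (intro witness[of r p p]) (auto simp: triangle_compat_def)
  next
    case 4
    with c show ?thesis by (intro witness[of p p q]) (auto simp: triangle_compat_def)
  next
    case 5
    with c show ?thesis by (intro witness[of q p p]) (auto simp: triangle_compat_def)
  next
    case 6
    with c show ?thesis by (intro witness[of q q p]) (auto simp: triangle_compat_def)
  next
    case 7
    with c show ?thesis by (intro witness[of q p q]) (auto simp: triangle_compat_def)
  next
    case 8
    with c show ?thesis by (intro witness[of q p r]) (auto simp: triangle_compat_def)
  next
    case 9
    with c show ?thesis by (intro witness[of r q p]) (auto simp: triangle_compat_def)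
  next
    case 10
    with c show ?thesis by (intro witness[of p r q]) (auto simp: triangle_compat_def)
  next
    case 11
    with c show ?thesis by (intro witness[of q r p]) (auto simp: triangle_compat_def)
  next
    case 12
    with c show ?thesis by (intro witness[of r p q]) (auto simp: triangle_compat_def)
  qed
qed

text \<open>Off the triangle nothing changes, so \<open>F i\<close> is the common remainder of class
  \<open>i\<close> for \<open>c\<close> and \<open>c'\<close>, and
  \<open>forest_triangle_iff\<close> decides by the three colours alone. The connectivity required
  there comes from \<open>cf_colouring_connected\<close>.\<close>

lemma cf_colouring_triangle_iff:
  assumes c: "cf_colouring V C c" and V: "x \<in> V" "y \<in> V" "z \<in> V" "x \<noteq> y" "x \<noteq> z" "y \<noteq> z"
    and eq: "\<forall>e \<in> edges V - {{x, y}, {x, z}, {y, z}}. c e = c' e"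
    and F: "\<And>i. F i = colour_class V c i - {{x, y}, {x, z}, {y, z}}"
  shows "cf_colouring V C c' \<longleftrightarrow> c' {x, y} \<in> C \<and> c' {x, z} \<in> C \<and> c' {y, z} \<in> C
    \<and> (\<forall>i\<in>C. triangle_compat ((x, y) \<in> conn (F i)) ((x, z) \<in> conn (F i)) ((y, z) \<in> conn (F i))
         (c' {x, y} = i) (c' {x, z} = i) (c' {y, z} = i))"
proof -
  note D = cf_colouringD[OF c]
  have dis: "{x, y} \<noteq> {x, z}" "{x, y} \<noteq> {y, z}" "{x, z} \<noteq> {y, z}"
    using V by (auto simp: doubleton_eq_iff)
  have cls: "colour_class V c' i = F i \<union> (if c' {x, y} = i then {{x, y}} else {})
      \<union> (if c' {x, z} = i then {{x, z}} else {}) \<union> (if c' {y, z} = i then {{y, z}} else {})"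
    (is "_ = ?R") for i
  proof (rule set_eqI)
    fix e
    show "e \<in> colour_class V c' i \<longleftrightarrow> e \<in> ?R"
    proof (cases "e \<in> {{x, y}, {x, z}, {y, z}}")
      case True
      then consider "e = {x, y}" | "e = {x, z}" | "e = {y, z}" by fast
      then show ?thesis
        by cases (use V dis dis[symmetric] in \<open>simp_all add: F\<close>)
    next
      case False
      then show ?thesis using eq by (cases "e \<in> edges V") (simp_all add: F)
    qed
  qed
  have iff: "forest (colour_class V c' i) \<and> (x, y) \<in> conn (colour_class V c' i)
        \<and> (x, z) \<in> conn (colour_class V c' i)
      \<longleftrightarrow> triangle_compat ((x, y) \<in> conn (F i)) ((x, z) \<in> conn (F i)) ((y, z) \<in> conn (F i))
         (c' {x, y} = i) (c' {x, z} = i) (c' {y, z} = i)" if "i \<in> C" for i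
  proof (rule forest_triangle_iff[OF _ _ _ _ V(4-6) cls])
    show "forest (F i)"
      by (rule cf_colouring_forestI[OF c that]) (simp add: F)
  qed (simp_all add: F)
  show ?thesis
  proof
    assume c': "cf_colouring V C c'"
    show "c' {x, y} \<in> C \<and> c' {x, z} \<in> C \<and> c' {y, z} \<in> C
    \<and> (\<forall>i\<in>C. triangle_compat ((x, y) \<in> conn (F i)) ((x, z) \<in> conn (F i)) ((y, z) \<in> conn (F i))
         (c' {x, y} = i) (c' {x, z} = i) (c' {y, z} = i))"
      using V cf_colouringD(4,5)[OF c'] cf_colouring_connected[OF c'] by (simp flip: iff)
  next
    assume R: "c' {x, y} \<in> C \<and> c' {x, z} \<in> C \<and> c' {y, z} \<in> C
    \<and> (\<forall>i\<in>C. triangle_compat ((x, y) \<in> conn (F i)) ((x, z) \<in> conn (F i)) ((y, z) \<in> conn (F i))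
         (c' {x, y} = i) (c' {x, z} = i) (c' {y, z} = i))"
    have "c' e \<in> C" if "e \<in> edges V" for e
    proof (cases "e \<in> {{x, y}, {x, z}, {y, z}}")
      case True
      then show ?thesis using R by (metis empty_iff insert_iff)
    next
      case False
      then show ?thesis using eq D(4)[OF that] that by simp
    qed
    moreover have "forest (colour_class V c' i)" if "i \<in> C" for i
      using R iff[OF that] that by simp
    ultimately show "cf_colouring V C c'"
      using D by (auto simp: cf_colouring_def)
  qed
qed

text \<open>The involution in the language of colourings, with \<open>c'\<close> taken from
  \<open>triangle_compat_other_colours\<close>. The last clause is the uniqueness that later
  evaluates the definite description in \<open>involution\<close>.\<close>

lemma cf_colouring_flip:
  assumes c: "cf_colouring V C c" and V: "x \<in> V" "y \<in> V" "z \<in> V" "x \<noteq> y" "x \<noteq> z" "y \<noteq> z"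
  obtains c' where "cf_colouring V C c'"
    "\<forall>e \<in> edges V - {{x, y}, {x, z}, {y, z}}. c e = c' e"
    "c {x, y} \<noteq> c' {x, y} \<and> c {x, z} \<noteq> c' {x, z} \<or> c {x, y} \<noteq> c' {x, y} \<and> c {y, z} \<noteq> c' {y, z}
      \<or> c {x, z} \<noteq> c' {x, z} \<and> c {y, z} \<noteq> c' {y, z}"
    "\<forall>b. cf_colouring V C b \<longrightarrow> (\<forall>e \<in> edges V - {{x, y}, {x, z}, {y, z}}. c e = b e)
      \<longrightarrow> (\<forall>e\<in>edges V. b e = c e) \<or> (\<forall>e\<in>edges V. b e = c' e)"
proof -
  define F where "F i = colour_class V c i - {{x, y}, {x, z}, {y, z}}" for i
  let ?ok = "\<lambda>p q r. \<forall>i\<in>C. triangle_compat ((x, y) \<in> conn (F i)) ((x, z) \<in> conn (F i))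
    ((y, z) \<in> conn (F i)) (p = i) (q = i) (r = i)"
  note iff = cf_colouring_triangle_iff[OF c V _ F_def]
  have ok: "c {x, y} \<in> C" "c {x, z} \<in> C" "c {y, z} \<in> C" "?ok (c {x, y}) (c {x, z}) (c {y, z})"
    using c iff[of c] by simp_all
  obtain p q r where pqr: "{p, q, r} \<subseteq> C" "?ok p q r"
    "c {x, y} \<noteq> p \<and> c {x, z} \<noteq> q \<or> c {x, y} \<noteq> p \<and> c {y, z} \<noteq> r \<or> c {x, z} \<noteq> q \<and> c {y, z} \<noteq> r"
    "\<And>s t u. s \<in> C \<Longrightarrow> t \<in> C \<Longrightarrow> u \<in> C \<Longrightarrow> ?ok s t u
      \<Longrightarrow> (s, t, u) = (c {x, y}, c {x, z}, c {y, z}) \<or> (s, t, u) = (p, q, r)"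
    using triangle_compat_other_colours[OF ok(1-3), of "\<lambda>i. (x, y) \<in> conn (F i)"
      "\<lambda>i. (x, z) \<in> conn (F i)" "\<lambda>i. (y, z) \<in> conn (F i)"] ok(4) by auto
  have dis: "{x, y} \<noteq> {x, z}" "{x, y} \<noteq> {y, z}" "{x, z} \<noteq> {y, z}"
    using V by (auto simp: doubleton_eq_iff)
  define c' where "c' = c({x, y} := p, {x, z} := q, {y, z} := r)"
  have c'xyz: "c' {x, y} = p" "c' {x, z} = q" "c' {y, z} = r"
    using dis by (auto simp: c'_def)
  have off: "\<forall>e \<in> edges V - {{x, y}, {x, z}, {y, z}}. c e = c' e"
    by (simp add: c'_def)
  show ?thesis
  proof (rule that[OF _ off])
    show "cf_colouring V C c'"
      using iff[OF off] pqr(1,2) by (simp add: c'xyz)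
    show "c {x, y} \<noteq> c' {x, y} \<and> c {x, z} \<noteq> c' {x, z} \<or> c {x, y} \<noteq> c' {x, y} \<and> c {y, z} \<noteq> c' {y, z}
      \<or> c {x, z} \<noteq> c' {x, z} \<and> c {y, z} \<noteq> c' {y, z}"
      using pqr(3) by (simp add: c'xyz)
    have "(\<forall>e\<in>edges V. b e = c e) \<or> (\<forall>e\<in>edges V. b e = c' e)"
      if b: "cf_colouring V C b" and boff: "\<forall>e \<in> edges V - {{x, y}, {x, z}, {y, z}}. c e = b e" for b
    proof -
    have "(b {x, y}, b {x, z}, b {y, z}) = (c {x, y}, c {x, z}, c {y, z})
        \<or> (b {x, y}, b {x, z}, b {y, z}) = (p, q, r)"
      using iff[OF boff] b by (intro pqr(4)) simp_all
    then show ?thesis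
    proof (elim disjE)
      assume bc: "(b {x, y}, b {x, z}, b {y, z}) = (c {x, y}, c {x, z}, c {y, z})"
      have "b e = c e" if "e \<in> edges V" for e
        using bc boff that by (cases "e = {x, y}"; cases "e = {x, z}"; cases "e = {y, z}"; simp)
      then show ?thesis by simp
    next
      assume bc: "(b {x, y}, b {x, z}, b {y, z}) = (p, q, r)"
      have "b e = c' e" if "e \<in> edges V" for e
        using bc boff off that
        by (cases "e = {x, y}"; cases "e = {x, z}"; cases "e = {y, z}"; simp add: c'xyz)
      then show ?thesis by simp
    qed
    qed
    then show "\<forall>b. cf_colouring V C b \<longrightarrow> (\<forall>e \<in> edges V - {{x, y}, {x, z}, {y, z}}. c e = b e)
      \<longrightarrow> (\<forall>e\<in>edges V. b e = c e) \<or> (\<forall>e\<in>edges V. b e = c' e)"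
      by blast
  qed
qed

text \<open>The first disjunct is there because colourings may differ outside \<open>edges V\<close>.\<close>

definition flip_step :: "'v set \<Rightarrow> 'c set \<Rightarrow> ('v set \<Rightarrow> 'c) \<Rightarrow> ('v set \<Rightarrow> 'c) \<Rightarrow> bool" where
  "flip_step V C c c' \<longleftrightarrow> cf_colouring V C c \<and> cf_colouring V C c' \<and> ((\<forall>e\<in>edges V. c e = c' e)
     \<or> (\<exists>x\<in>V. \<exists>y\<in>V. \<exists>z\<in>V. x \<noteq> y \<and> x \<noteq> z \<and> y \<noteq> z
          \<and> (\<forall>e \<in> edges V - {{x, y}, {x, z}, {y, z}}. c e = c' e)))"

abbreviation flip_equiv :: "'v set \<Rightarrow> 'c set \<Rightarrow> ('v set \<Rightarrow> 'c) \<Rightarrow> ('v set \<Rightarrow> 'c) \<Rightarrow> bool" where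
  "flip_equiv V C \<equiv> (flip_step V C)\<^sup>*\<^sup>*"

lemma flip_step_cf:
  assumes "flip_step V C c c'"
  shows "cf_colouring V C c" "cf_colouring V C c'"
  using assms by (auto simp: flip_step_def)

lemma flip_equiv_eqI:
  assumes "cf_colouring V C c" "\<And>e. e \<in> edges V \<Longrightarrow> c e = c' e"
  shows "flip_equiv V C c c'"
proof -
  have "cf_colouring V C c'"
    by (rule cf_colouring_cong[OF assms(1)]) (simp add: assms(2))
  then have "flip_step V C c c'"
    using assms by (simp add: flip_step_def)
  then show ?thesis by (rule r_into_rtranclp[of "flip_step V C"])
qed

text \<open>By \<open>cf_colouring_flip\<close>, two cycle-free colourings agreeing off a triangle
  are equal or exchanged by its flip, so a move is verified by checking both ends, without computing
  an involution.\<close>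

lemma flip_equivI:
  assumes "cf_colouring V C c" "cf_colouring V C c'" "x \<in> V" "y \<in> V" "z \<in> V"
    "x \<noteq> y" "x \<noteq> z" "y \<noteq> z"
    "\<And>e. e \<in> edges V \<Longrightarrow> e \<noteq> {x, y} \<Longrightarrow> e \<noteq> {x, z} \<Longrightarrow> e \<noteq> {y, z} \<Longrightarrow> c e = c' e"
  shows "flip_equiv V C c c'"
proof -
  have "\<forall>e \<in> edges V - {{x, y}, {x, z}, {y, z}}. c e = c' e"
    using assms(9) by simp
  then have "flip_step V C c c'"
    using assms(1-8) unfolding flip_step_def by blast
  then show ?thesis by (rule r_into_rtranclp[of "flip_step V C"])
qed

lemma flip_equiv_sym: "flip_equiv V C c c' \<Longrightarrow> flip_equiv V C c' c"
proof (rule sympD[OF symp_rtranclp])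
  show "symp (flip_step V C)"
    unfolding symp_def flip_step_def by (metis (no_types, lifting))
qed

section \<open>Twin stars\<close>

text \<open>Class \<open>j\<close> is a twin star whose centres \<open>a\<close>, \<open>b\<close> have the leaves \<open>A\<close>, \<open>B\<close>; every other
  class meets each centre in a single edge, which leads to a leaf of the other centre.\<close>

definition twin_star_at ::
  "'v set \<Rightarrow> 'c set \<Rightarrow> ('v set \<Rightarrow> 'c) \<Rightarrow> 'c \<Rightarrow> 'v \<Rightarrow> 'v \<Rightarrow> 'v set \<Rightarrow> 'v set \<Rightarrow> bool" where
  "twin_star_at V C c j a b A B \<longleftrightarrow> V = insert a (insert b (A \<union> B)) \<and> a \<noteq> b \<and> a \<notin> A \<union> B \<and> b \<notin> A \<union> B
     \<and> A \<inter> B = {} \<and> j \<in> C \<and> c {a, b} = j \<and> (\<forall>u\<in>A. c {a, u} = j) \<and> (\<forall>v\<in>B. c {b, v} = j)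
     \<and> bij_betw (\<lambda>u. c {b, u}) A (C - {j}) \<and> bij_betw (\<lambda>v. c {a, v}) B (C - {j})
     \<and> cf_colouring (A \<union> B) (C - {j}) c"

lemma twin_star_atD:
  assumes "twin_star_at V C c j a b A B"
  shows "V = insert a (insert b (A \<union> B))" "a \<noteq> b" "a \<notin> A" "a \<notin> B" "b \<notin> A" "b \<notin> B"
    "A \<inter> B = {}" "j \<in> C" "c {a, b} = j" "\<And>u. u \<in> A \<Longrightarrow> c {a, u} = j" "\<And>v. v \<in> B \<Longrightarrow> c {b, v} = j"
    "bij_betw (\<lambda>u. c {b, u}) A (C - {j})" "bij_betw (\<lambda>v. c {a, v}) B (C - {j})"
    "cf_colouring (A \<union> B) (C - {j}) c" "finite A" "finite B" "finite C"
    "card A = card C - 1" "card B = card C - 1"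
proof -
  show "V = insert a (insert b (A \<union> B))" "a \<noteq> b" "a \<notin> A" "a \<notin> B" "b \<notin> A" "b \<notin> B"
    "A \<inter> B = {}" "c {a, b} = j" "\<And>u. u \<in> A \<Longrightarrow> c {a, u} = j" "\<And>v. v \<in> B \<Longrightarrow> c {b, v} = j"
    using assms by (simp_all add: twin_star_at_def)
  show bij: "bij_betw (\<lambda>u. c {b, u}) A (C - {j})" "bij_betw (\<lambda>v. c {a, v}) B (C - {j})"
    and cf: "cf_colouring (A \<union> B) (C - {j}) c" and "j \<in> C"
    using assms by (simp_all add: twin_star_at_def)
  then show "finite A" "finite B" "finite C"
    using cf_colouringD(1,2)[OF cf] by simp_all
  then show "card A = card C - 1" "card B = card C - 1"
    using bij_betw_same_card[OF bij(1)] bij_betw_same_card[OF bij(2)] \<open>j \<in> C\<close> by simp_all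
qed

lemma edges_two_more_cases:
  assumes "e \<in> edges (insert a (insert b W))"
  obtains "e = {a, b}" | w where "w \<in> W" "e = {a, w}" | w where "w \<in> W" "e = {b, w}" | "e \<in> edges W"
proof -
  obtain x y where e: "e = {x, y}" "x \<in> insert a (insert b W)" "y \<in> insert a (insert b W)" "x \<noteq> y"
    using assms by (rule edgesE)
  show thesis
  proof (cases "x \<in> W \<and> y \<in> W")
    case True
    then show thesis using that(4) e by simp
  next
    case False
    then consider "x = a" "y = b" | "x = b" "y = a" | "x = a" "y \<in> W" | "y = a" "x \<in> W"
      | "x = b" "y \<in> W" | "y = b" "x \<in> W"
      using e(2-4) by auto
    then show thesis
      using that(1-3) e(1) insert_commute[of x y "{}"] by cases metis+
  qed
qed

lemma twin_star_at_sym: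
  assumes "twin_star_at V C c j a b A B"
  shows "twin_star_at V C c j b a B A"
  using twin_star_atD[OF assms] unfolding twin_star_at_def
  by (simp add: insert_commute[of b a] Un_commute[of B A] Int_commute[of B A])

lemma forest_insert_leaves:
  assumes "finite A" "forest E" "A \<inter> \<Union>E = {}" "p ` A \<inter> A = {}"
  shows "forest (E \<union> (\<lambda>u. {u, p u}) ` A)"
  using assms
proof (induction A rule: finite_induct)
  case (insert x A)
  have "forest (insert {x, p x} (E \<union> (\<lambda>u. {u, p u}) ` A))"
    by (rule forest_insert_leaf) (use insert in auto)
  then show ?case by simp
qed simp

text \<open>Class \<open>j\<close> arises from the edge \<open>{a, b}\<close> by attaching leaves,
  and each other class from an inner forest by attaching \<open>a\<close> and \<open>b\<close> as
  leaves.\<close>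

lemma twin_star_at_cf_colouring:
  assumes S: "twin_star_at V C c j a b A B"
  shows "cf_colouring V C c"
proof -
  note D = twin_star_atD[OF S]
  note I = cf_colouringD[OF D(14)]
  have ran: "c e \<in> C" if e: "e \<in> edges V" for e
    using e[unfolded D(1)]
  proof (cases rule: edges_two_more_cases)
    case (2 w)
    then show ?thesis using D(8,10) bij_betwE[OF D(13)] by auto
  next
    case (3 w)
    then show ?thesis using D(8,11) bij_betwE[OF D(12)] by auto
  qed (use D(8,9) I(4) in auto)
  have "card V = card A + card B + 2"
    using D by (simp add: card_Un_disjoint)
  moreover have "card C > 0"
    using D(8,17) card_gt_0_iff by blast
  ultimately have card: "card V = 2 * card C"
    using D(18,19) by simp
  have "forest (colour_class V c i)" if i: "i \<in> C" for i
  proof (cases "i = j")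
    case True
    \<comment> \<open>The centre to which a leaf is attached.\<close>
    define p where "p u = (if u \<in> A then a else b)" for u
    have "forest (insert {a, b} {} \<union> (\<lambda>u. {u, p u}) ` (A \<union> B))"
      by (rule forest_insert_leaves, use D in simp, rule forest_insert_leaf)
        (use D in \<open>auto simp: p_def\<close>)
    moreover have "e \<in> insert {a, b} {} \<union> (\<lambda>u. {u, p u}) ` (A \<union> B)" if e: "e \<in> colour_class V c i" for e
    proof -
      have "e \<in> edges (insert a (insert b (A \<union> B)))" "c e = j"
        using e True D(1) by simp_all
      then show ?thesis
      proof (cases rule: edges_two_more_cases)
        case (2 w)
        then have "w \<notin> B" using \<open>c e = j\<close> bij_betwE[OF D(13)] by auto
        then show ?thesis using 2 by (auto simp: p_def insert_commute)
      next
        case (3 w)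
        then have "w \<notin> A" using \<open>c e = j\<close> bij_betwE[OF D(12)] by auto
        then show ?thesis using 3 by (auto simp: p_def insert_commute)
      next
        case 4
        then show ?thesis using I(4) \<open>c e = j\<close> by auto
      qed simp
    qed
    ultimately show ?thesis
      by (meson forest_subset subsetI)
  next
    case False
    then have ij: "i \<in> C - {j}" using i by simp
    have "i \<in> (\<lambda>u. c {b, u}) ` A" "i \<in> (\<lambda>v. c {a, v}) ` B"
      using bij_betw_imp_surj_on[OF D(12)] bij_betw_imp_surj_on[OF D(13)] ij by simp_all
    then obtain u v where u: "u \<in> A" "c {b, u} = i" and v: "v \<in> B" "c {a, v} = i"
      by auto
    have u': "u' = u" if "u' \<in> A" "c {b, u'} = i" for u'
      using inj_onD[OF bij_betw_imp_inj_on[OF D(12)], of u' u] u that by simp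
    have v': "v' = v" if "v' \<in> B" "c {a, v'} = i" for v'
      using inj_onD[OF bij_betw_imp_inj_on[OF D(13)], of v' v] v that by simp
    let ?E = "colour_class (A \<union> B) c i"
    have sub: "\<Union>?E \<subseteq> A \<union> B"
      by (auto simp: edges_def)
    have "forest (insert {a, v} ?E)"
      by (rule forest_insert_leaf[OF I(5)[OF ij]]) (use sub D v in auto)
    then have "forest (insert {b, u} (insert {a, v} ?E))"
      by (rule forest_insert_leaf) (use sub D u v in auto)
    moreover have "e \<in> insert {b, u} (insert {a, v} ?E)" if e: "e \<in> colour_class V c i" for e
    proof -
      have "e \<in> edges (insert a (insert b (A \<union> B)))" "c e = i"
        using e D(1) by simp_all
      then show ?thesis
        using False D(9,10,11) u' v' by (cases rule: edges_two_more_cases) auto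
    qed
    ultimately show ?thesis
      by (meson forest_subset subsetI)
  qed
  then show ?thesis
    using D(15-17) ran card unfolding cf_colouring_def D(1) by auto
qed

text \<open>The star edges already span \<open>V\<close>, so class \<open>j\<close> has no others.
  Every other class, being connected, must leave \<open>a\<close> towards \<open>B\<close> and
  \<open>b\<close> towards \<open>A\<close>, and equal cardinalities turn these surjections onto the
  remaining colours into bijections.\<close>

lemma twin_star_atI:
  assumes c: "cf_colouring V C c" and j: "j \<in> C"
    and V: "V = insert a (insert b (A \<union> B))" "a \<noteq> b" "a \<notin> A \<union> B" "b \<notin> A \<union> B" "A \<inter> B = {}" "card A = card B"
    and ab: "c {a, b} = j" and A: "\<And>u. u \<in> A \<Longrightarrow> c {a, u} = j" and B: "\<And>v. v \<in> B \<Longrightarrow> c {b, v} = j"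
  shows "twin_star_at V C c j a b A B"
proof -
  note D = cf_colouringD[OF c]
  have fin: "finite A" "finite B"
    using D(1) V(1) by simp_all
  define S where "S = insert {a, b} ((\<lambda>u. {a, u}) ` A \<union> (\<lambda>v. {b, v}) ` B)"
  have "(a, p) \<in> conn S" if "p \<in> V" for p
  proof -
    have "(a, b) \<in> conn S" by (rule conn_edge) (simp add: S_def)
    moreover have "(a, p) \<in> conn S" if "p \<in> A" using that by (intro conn_edge) (simp add: S_def)
    moreover have "(b, p) \<in> conn S" if "p \<in> B" using that by (intro conn_edge) (simp add: S_def)
    ultimately show ?thesis
      using that V(1) conn_trans by (metis (no_types) Un_iff conn_refl insert_iff)
  qed
  then have conn: "(p, q) \<in> conn S" if "p \<in> V" "q \<in> V" for p q
    using that by (meson conn_sym conn_trans)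
  have S: "S \<subseteq> colour_class V c j"
  proof
    fix e assume "e \<in> S"
    then consider "e = {a, b}" | u where "u \<in> A" "e = {a, u}" | v where "v \<in> B" "e = {b, v}"
      unfolding S_def by fast
    then show "e \<in> colour_class V c j"
      using V ab A B by cases auto
  qed
  \<comment> \<open>A further edge of colour \<open>j\<close> would be no bridge, since its ends are
    joined within \<open>S\<close>.\<close>
  have only: "e \<in> S" if e: "e \<in> edges V" "c e = j" for e
  proof (rule ccontr)
    assume "e \<notin> S"
    obtain p q where pq: "e = {p, q}" "p \<in> V" "q \<in> V" using e(1) by (rule edgesE)
    have "(p, q) \<notin> conn (colour_class V c j - {{p, q}})"
      using D(5)[OF j] e pq by (simp add: forest_def)
    moreover have "S \<subseteq> colour_class V c j - {{p, q}}"
      using S \<open>e \<notin> S\<close> pq(1) by blast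
    ultimately show False
      using conn_mono[OF conn[OF pq(2,3)]] by simp
  qed
  have aB: "c {a, v} \<noteq> j" if "v \<in> B" for v
  proof -
    have "{a, v} \<notin> S"
      using that V by (auto simp: S_def doubleton_eq_iff)
    moreover have "{a, v} \<in> edges V"
      using that V by auto
    ultimately show ?thesis using only by metis
  qed
  have bA: "c {b, u} \<noteq> j" if "u \<in> A" for u
  proof -
    have "{b, u} \<notin> S"
      using that V by (auto simp: S_def doubleton_eq_iff)
    moreover have "{b, u} \<in> edges V"
      using that V by auto
    ultimately show ?thesis using only by metis
  qed
  have sub: "edges (A \<union> B) \<subseteq> edges V"
    using V(1) by (intro edges_mono) auto
  have AB: "c e \<in> C - {j}" if e: "e \<in> edges (A \<union> B)" for e
  proof -
    have "e \<notin> S" using e V by (auto simp: S_def)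
    moreover have "e \<in> edges V" using sub e by (rule subsetD)
    ultimately show ?thesis using only[of e] D(4)[of e] by auto
  qed
  have "card V = 2 + 2 * card B"
    using V fin by (simp add: card_Un_disjoint)
  then have card: "card B = card (C - {j})"
    using D(2,3) j by simp
  have surj: "i \<in> (\<lambda>v. c {a, v}) ` B" "i \<in> (\<lambda>u. c {b, u}) ` A" if i: "i \<in> C" "i \<noteq> j" for i
  proof -
    have "(a, b) \<in> conn (colour_class V c i)" "(b, a) \<in> conn (colour_class V c i)"
      using cf_colouring_connected[OF c i(1)] V(1) by simp_all
    then obtain v u where v: "{a, v} \<in> colour_class V c i" and u: "{b, u} \<in> colour_class V c i"
      using V(2) conn_leaves_vertex by metis
    have "v \<in> B"
      using v V(1) ab A[of v] i by auto
    then show "i \<in> (\<lambda>v. c {a, v}) ` B"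
      using v by auto
    have "u \<in> A"
      using u V(1) ab B[of u] i insert_commute[of b a "{}"] by auto
    then show "i \<in> (\<lambda>u. c {b, u}) ` A"
      using u by auto
  qed
  have "c {a, v} \<in> C" if "v \<in> B" for v using D(4)[of "{a, v}"] that V by auto
  then have imB: "(\<lambda>v. c {a, v}) ` B = C - {j}"
    using surj(1) aB by auto
  have "c {b, u} \<in> C" if "u \<in> A" for u using D(4)[of "{b, u}"] that V by auto
  then have imA: "(\<lambda>u. c {b, u}) ` A = C - {j}"
    using surj(2) bA by auto
  have bij: "bij_betw (\<lambda>v. c {a, v}) B (C - {j})" "bij_betw (\<lambda>u. c {b, u}) A (C - {j})"
    using imA imB fin card V(6) by (simp_all add: bij_betw_def eq_card_imp_inj_on)
  have "cf_colouring (A \<union> B) (C - {j}) c"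
    unfolding cf_colouring_def
  proof (intro conjI ballI)
    show "card (A \<union> B) = 2 * card (C - {j})"
      using card V(5,6) fin by (simp add: card_Un_disjoint)
    show "forest (colour_class (A \<union> B) c i)" if "i \<in> C - {j}" for i
      using that sub by (intro cf_colouring_forestI[OF c, of i]) auto
  qed (use fin D(2) AB in auto)
  then show ?thesis
    unfolding twin_star_at_def using V(1-5) j ab A B bij by simp
qed

section \<open>Moves between twin stars with the same centres and leaves\<close>

lemma bij_betw_replace:
  assumes f: "bij_betw f A T" and "u \<in> A" "v \<notin> A" "g v = f u" "\<And>w. w \<in> A - {u} \<Longrightarrow> g w = f w"
  shows "bij_betw g (insert v (A - {u})) T"
proof -
  have inj: "f x = f y \<longleftrightarrow> x = y" if "x \<in> A" "y \<in> A" for x y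
    using inj_on_eq_iff[OF bij_betw_imp_inj_on[OF f] that] .
  have "g ` (A - {u}) = f ` (A - {u})"
    using assms(5) by (rule image_cong[OF refl])
  then have "g ` insert v (A - {u}) = f ` insert u (A - {u})"
    using assms(4) by (simp only: image_insert)
  also have "\<dots> = T"
    using f \<open>u \<in> A\<close> by (simp add: insert_absorb bij_betw_imp_surj_on)
  finally show ?thesis
    using assms(2-5) inj by (auto simp: bij_betw_def inj_on_def)
qed

lemma bij_betw_exchange:
  assumes f: "bij_betw f A T" and "u \<in> A" "v \<in> A" "g v = f u" "g u = f v"
    "\<And>w. w \<in> A - {u, v} \<Longrightarrow> g w = f w"
  shows "bij_betw g A T"
proof -
  have "bij_betw (f \<circ> Transposition.transpose u v) A T"
    using f assms(2,3) permutes_imp_bij[OF permutes_swap_id] bij_betw_trans by metis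
  moreover have "g w = (f \<circ> Transposition.transpose u v) w" if "w \<in> A" for w
    using assms(4-6) that by (auto simp: Transposition.transpose_def)
  ultimately show ?thesis
    by (simp cong: bij_betw_cong)
qed

lemma twin_star_at_inner_replace:
  assumes S: "twin_star_at V C c j a b A B" and g: "cf_colouring (A \<union> B) (C - {j}) g"
  shows "twin_star_at V C (\<lambda>e. if e \<in> edges (A \<union> B) then g e else c e) j a b A B"
proof -
  note D = twin_star_atD[OF S]
  have "cf_colouring (A \<union> B) (C - {j}) (\<lambda>e. if e \<in> edges (A \<union> B) then g e else c e)"
    by (rule cf_colouring_cong[OF g]) simp
  then show ?thesis
    using D unfolding twin_star_at_def by simp
qed

text \<open>Inner triangles are triangles of \<open>V\<close>, and by
  \<open>twin_star_at_inner_replace\<close> every inner cycle-free colouring may be put in, so a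
  chain of inner flips lifts step by step.\<close>

lemma twin_star_at_inner_flip:
  assumes S: "twin_star_at V C c j a b A B" and g: "flip_equiv (A \<union> B) (C - {j}) c g"
  shows "flip_equiv V C c (\<lambda>e. if e \<in> edges (A \<union> B) then g e else c e)"
  using g
proof (induction rule: rtranclp_induct)
  case base
  then show ?case by simp
next
  case (step g h)
  note D = twin_star_atD[OF S]
  let ?m = "\<lambda>g e. if e \<in> edges (A \<union> B) then g e else c e"
  have cf: "cf_colouring V C (?m g)" "cf_colouring V C (?m h)"
    using twin_star_at_cf_colouring[OF twin_star_at_inner_replace[OF S]] flip_step_cf[OF step.hyps(2)]
    by blast+
  have sub: "A \<union> B \<subseteq> V" using D(1) by auto
  have "flip_equiv V C (?m g) (?m h)"
  proof (cases "\<forall>e\<in>edges (A \<union> B). g e = h e")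
    case True
    then show ?thesis by (intro flip_equiv_eqI[OF cf(1)]) simp
  next
    case False
    then obtain x y z where xyz: "x \<in> A \<union> B" "y \<in> A \<union> B" "z \<in> A \<union> B" "x \<noteq> y" "x \<noteq> z" "y \<noteq> z"
      and off: "\<forall>e \<in> edges (A \<union> B) - {{x, y}, {x, z}, {y, z}}. g e = h e"
      using step.hyps(2) unfolding flip_step_def by metis
    show ?thesis
      by (rule flip_equivI[OF cf, of x y z]) (use xyz off subsetD[OF sub] in simp_all)
  qed
  with step.IH show ?case by (rule rtranclp_trans)
qed

text \<open>Only the bijection from \<open>B\<close> onto the other colours changes, by a
  transposition, so the twin star persists; all changes lie in the triangle
  \<open>a v v'\<close>.\<close>

lemma twin_star_at_swap_colours:
  assumes S: "twin_star_at V C c j a b A B" and v: "v \<in> B" "v' \<in> B" "v \<noteq> v'"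
    and c': "c' = c({a, v} := c {a, v'}, {a, v'} := c {a, v})"
  shows "twin_star_at V C c' j a b A B" "flip_equiv V C c c'"
proof -
  note D = twin_star_atD[OF S]
  have ne: "{a, v} \<noteq> {a, v'}" "{b, w} \<noteq> {a, v}" "{b, w} \<noteq> {a, v'}"
    "{a, w} = {a, v} \<longleftrightarrow> w = v" "{a, w} = {a, v'} \<longleftrightarrow> w = v'" for w
    using D(2-6) v by (auto simp: doubleton_eq_iff)
  have inner: "e \<noteq> {a, v}" "e \<noteq> {a, v'}" if "e \<in> edges (A \<union> B)" for e
    using that D(3,4) by auto
  have bij: "bij_betw (\<lambda>w. c' {a, w}) B (C - {j})"
    by (rule bij_betw_exchange[OF D(13) v(1,2)]) (simp_all add: c' ne v(3) v(3)[symmetric])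
  have c'A: "c' {a, u} = j" if "u \<in> A" for u
  proof -
    have "u \<noteq> v" "u \<noteq> v'" using that v D(7) by auto
    then show ?thesis using D(10)[OF that] by (simp add: c' ne)
  qed
  have c'ab: "c' {a, b} = j"
    using D(6,9) v by (auto simp: c' ne)
  have c'b: "c' {b, w} = c {b, w}" for w
    by (simp add: c' ne)
  have "cf_colouring (A \<union> B) (C - {j}) c'"
    by (rule cf_colouring_cong[OF D(14)]) (simp add: c' inner)
  then show S': "twin_star_at V C c' j a b A B"
    unfolding twin_star_at_def using D(1-12) c'A c'ab c'b bij by simp
  show "flip_equiv V C c c'"
    by (rule flip_equivI[OF twin_star_at_cf_colouring[OF S] twin_star_at_cf_colouring[OF S'],
          of a v v']) (use v D(1,4) in \<open>auto simp: c'\<close>)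
qed

text \<open>Two bijections from \<open>B\<close> onto the same colours differ by transpositions; the
  number of misplaced leaves decreases with each swap.\<close>

lemma twin_star_at_align_leaves:
  assumes "twin_star_at V C c j a b A B" "twin_star_at V C c' j a b A B"
    "\<And>e. e \<in> edges V \<Longrightarrow> e \<notin> (\<lambda>v. {a, v}) ` B \<Longrightarrow> c e = c' e"
  shows "flip_equiv V C c c'"
  using assms(1,3)
proof (induction "card {v \<in> B. c {a, v} \<noteq> c' {a, v}}" arbitrary: c rule: less_induct)
  case less
  note D = twin_star_atD[OF less.prems(1)] and D' = twin_star_atD[OF assms(2)]
  show ?case
  proof (cases "\<forall>v\<in>B. c {a, v} = c' {a, v}")
    case True
    show ?thesis
    proof (rule flip_equiv_eqI[OF twin_star_at_cf_colouring[OF less.prems(1)]])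
      fix e assume "e \<in> edges V"
      then show "c e = c' e"
        using True less.prems(2)[of e] by (cases "e \<in> (\<lambda>v. {a, v}) ` B") auto
    qed
  next
    case False
    then obtain v where v: "v \<in> B" "c {a, v} \<noteq> c' {a, v}" by blast
    have "c' {a, v} \<in> (\<lambda>v. c {a, v}) ` B"
      using bij_betwE[OF D'(13)] bij_betw_imp_surj_on[OF D(13)] v(1) by simp
    then obtain v' where v': "v' \<in> B" "c {a, v'} = c' {a, v}" by auto
    have "v \<noteq> v'" using v v' by auto
    \<comment> \<open>\<open>v'\<close> is misplaced as well, so the swap repairs \<open>v\<close>
      without spoiling a correct leaf.\<close>
    have "c' {a, v'} \<noteq> c {a, v'}"
      using inj_onD[OF bij_betw_imp_inj_on[OF D'(13)], of v' v] v v' \<open>v \<noteq> v'\<close> by auto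
    define c1 where "c1 = c({a, v} := c {a, v'}, {a, v'} := c {a, v})"
    note c1 = twin_star_at_swap_colours[OF less.prems(1) v(1) v'(1) \<open>v \<noteq> v'\<close> c1_def]
    have eq: "{a, w} = {a, v} \<longleftrightarrow> w = v" "{a, w} = {a, v'} \<longleftrightarrow> w = v'" for w
      by (auto simp: doubleton_eq_iff)
    have "{w \<in> B. c1 {a, w} \<noteq> c' {a, w}} \<subseteq> {w \<in> B. c {a, w} \<noteq> c' {a, w}} - {v}"
      using \<open>c' {a, v'} \<noteq> c {a, v'}\<close> v' \<open>v \<noteq> v'\<close> by (auto simp: c1_def eq)
    also have "\<dots> \<subset> {w \<in> B. c {a, w} \<noteq> c' {a, w}}"
      using v by auto
    finally have "card {w \<in> B. c1 {a, w} \<noteq> c' {a, w}} < card {w \<in> B. c {a, w} \<noteq> c' {a, w}}"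
      using D(16) by (intro psubset_card_mono) auto
    moreover have "c1 e = c' e" if "e \<in> edges V" "e \<notin> (\<lambda>v. {a, v}) ` B" for e
    proof -
      have "e \<noteq> {a, v}" "e \<noteq> {a, v'}" using that(2) v(1) v'(1) by blast+
      then show ?thesis using less.prems(2)[OF that] by (simp add: c1_def)
    qed
    ultimately have "flip_equiv V C c1 c'"
      using less.hyps c1(1) by blast
    with c1(2) show ?thesis by (rule rtranclp_trans)
  qed
qed

text \<open>First the inner edges are adjusted by the induction hypothesis, then those from
  \<open>a\<close> to \<open>B\<close>, and finally those from \<open>b\<close> to \<open>A\<close>
  with the centres interchanged.\<close>

lemma twin_star_at_flip_equiv_same_leaves:
  assumes S: "twin_star_at V C c j a b A B" and S': "twin_star_at V C c' j a b A B"
    and IH: "\<And>g h. cf_colouring (V - {a, b}) (C - {j}) g \<Longrightarrow> cf_colouring (V - {a, b}) (C - {j}) h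
      \<Longrightarrow> flip_equiv (V - {a, b}) (C - {j}) g h"
  shows "flip_equiv V C c c'"
proof -
  note D = twin_star_atD[OF S] and D' = twin_star_atD[OF S']
  have W: "V - {a, b} = A \<union> B" using D(1-6) by auto
  \<comment> \<open>\<open>c1\<close> takes the inner edges from \<open>c'\<close>, and
    \<open>c2\<close> also the edges between \<open>a\<close> and \<open>B\<close>.\<close>
  define c1 where "c1 e = (if e \<in> edges (A \<union> B) then c' e else c e)" for e
  define c2 where "c2 e = (if e \<in> (\<lambda>v. {a, v}) ` B then c' e else c1 e)" for e
  have "flip_equiv (A \<union> B) (C - {j}) c c'"
    using IH D(14) D'(14) unfolding W by blast
  then have cc1: "flip_equiv V C c c1"
    using twin_star_at_inner_flip[OF S] unfolding c1_def by blast
  have S1: "twin_star_at V C c1 j a b A B"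
    using twin_star_at_inner_replace[OF S D'(14)] unfolding c1_def by simp
  have aw: "{a, w} \<in> (\<lambda>v. {a, v}) ` B \<longleftrightarrow> w \<in> B" for w
    by (auto simp: doubleton_eq_iff)
  have bw: "{b, w} \<notin> (\<lambda>v. {a, v}) ` B" for w
    using D(2,6) by (auto simp: doubleton_eq_iff)
  have inner: "e \<notin> (\<lambda>v. {a, v}) ` B" if "e \<in> edges (A \<union> B)" for e
    using that D(3,4) by auto
  have S2: "twin_star_at V C c2 j a b A B"
  proof -
    note E = twin_star_atD[OF S1]
    have "bij_betw (\<lambda>v. c2 {a, v}) B (C - {j})"
      using D'(13) by (simp add: c2_def aw cong: bij_betw_cong)
    moreover have "c2 {a, u} = j" if "u \<in> A" for u
    proof -
      have "u \<notin> B" using that D(7) by auto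
      then show ?thesis using E(10)[OF that] by (simp add: c2_def aw)
    qed
    moreover have "cf_colouring (A \<union> B) (C - {j}) c2"
      by (rule cf_colouring_cong[OF E(14)]) (simp add: c2_def inner)
    ultimately show ?thesis
      unfolding twin_star_at_def using E(1-9,11,12) by (simp add: c2_def aw bw)
  qed
  have c12: "flip_equiv V C c1 c2"
    by (rule twin_star_at_align_leaves[OF S1 S2]) (simp add: c2_def)
  have "flip_equiv V C c2 c'"
  proof (rule twin_star_at_align_leaves[OF twin_star_at_sym[OF S2] twin_star_at_sym[OF S']])
    fix e assume "e \<in> edges V" and no: "e \<notin> (\<lambda>v. {b, v}) ` A"
    then have "e \<in> edges (insert a (insert b (A \<union> B)))" using D(1) by simp
    then show "c2 e = c' e"
    proof (cases rule: edges_two_more_cases)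
      case 1
      then show ?thesis using twin_star_atD(9)[OF S2] D'(9) by simp
    next
      case (2 w)
      then show ?thesis using twin_star_atD(10)[OF S2] D'(10) by (cases "w \<in> B") (auto simp: c2_def)
    next
      case (3 w)
      then have "w \<in> B" using no by auto
      then show ?thesis using 3 twin_star_atD(11)[OF S2] D'(11) by simp
    next
      case 4
      then show ?thesis by (simp add: c2_def c1_def inner)
    qed
  qed
  with cc1 c12 show ?thesis by (meson rtranclp_trans)
qed

text \<open>In the class of the old colour of \<open>{b, u}\<close> the vertex \<open>b\<close> is
  merely re-attached at \<open>a\<close>; class \<open>j\<close> is covered by
  \<open>forest_exchange\<close>. The result serves as an intermediate colouring, since
  \<open>{a, b}\<close> has left class \<open>j\<close>.\<close>

lemma twin_star_at_pivot:
  assumes S: "twin_star_at V C c j a b A B" and u: "u \<in> A"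
    and c': "c' = c({a, b} := c {b, u}, {b, u} := j)"
  shows "cf_colouring V C c'" "flip_equiv V C c c'"
proof -
  note D = twin_star_atD[OF S]
  note c = twin_star_at_cf_colouring[OF S]
  note Dc = cf_colouringD[OF c]
  define i where "i = c {b, u}"
  have i: "i \<in> C" "i \<noteq> j" using bij_betwE[OF D(12)] u by (auto simp: i_def)
  have abu: "{a, b} \<noteq> {b, u}" using u D(3) by (auto simp: doubleton_eq_iff)
  have inV: "{a, b} \<in> edges V" "{b, u} \<in> edges V" "{a, u} \<in> edges V"
    using D(1-6) u by auto
  have c'_alt: "c' e = (if e = {b, u} then j else if e = {a, b} then i else c e)" for e
    by (simp add: c' i_def)
  show cf: "cf_colouring V C c'"
    unfolding cf_colouring_def
  proof (intro conjI ballI)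
    show "c' \<in> edges V \<rightarrow> C"
      using Dc(4) i D(8) by (auto simp: c'_alt)
    fix k assume k: "k \<in> C"
    consider "k = i" | "k = j" | "k \<noteq> i" "k \<noteq> j" by blast
    then show "forest (colour_class V c' k)"
    proof cases
      case 1
      let ?E = "colour_class V c i - {{b, u}}"
      \<comment> \<open>\<open>{b, u}\<close> is the only edge of class \<open>i\<close> at
        \<open>b\<close>, so \<open>b\<close> is isolated in \<open>?E\<close>.\<close>
      have "b \<notin> e" if e: "e \<in> ?E" for e
      proof
        assume "b \<in> e"
        have "e \<in> edges (insert a (insert b (A \<union> B)))" "c e = i" "e \<noteq> {b, u}"
          using e D(1) by simp_all
        then show False
        proof (cases rule: edges_two_more_cases)
          case 1
          then show False using \<open>c e = i\<close> i D(9) by simp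
        next
          case (2 w)
          then show False using \<open>b \<in> e\<close> D(2,5,6) by auto
        next
          case (3 w)
          have "w \<in> A" using 3 D(11)[of w] \<open>c e = i\<close> i by auto
          moreover have "w \<noteq> u" using 3 \<open>e \<noteq> {b, u}\<close> by auto
          ultimately show False
            using inj_onD[OF bij_betw_imp_inj_on[OF D(12)], of w u] u 3 \<open>c e = i\<close> i_def by simp
        next
          case 4
          then show False using \<open>b \<in> e\<close> D(5,6) by (auto simp: edges_def)
        qed
      qed
      moreover have "forest ?E"
        by (rule cf_colouring_forestI[OF c i(1)]) simp
      ultimately have "forest (insert {b, a} ?E)"
        using D(2) by (intro forest_insert_leaf) auto
      moreover have "colour_class V c' k \<subseteq> insert {b, a} ?E"
      proof
        fix e assume "e \<in> colour_class V c' k"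
        then show "e \<in> insert {b, a} ?E"
          using 1 i(2) insert_commute[of a b "{}"]
          by (cases "e = {b, u}"; cases "e = {a, b}") (simp_all add: c'_alt)
      qed
      ultimately show ?thesis by (rule forest_subset)
    next
      case 2
      show ?thesis
      proof (rule forest_exchange[OF Dc(5)[OF D(8)]])
        show "{a, b} \<in> colour_class V c j" "{a, u} \<in> colour_class V c j" "b \<noteq> u"
          using inV D(5,9,10) u by auto
        show "colour_class V c' k \<subseteq> insert {b, u} (colour_class V c j - {{a, b}})"
        proof
          fix e assume "e \<in> colour_class V c' k"
          then show "e \<in> insert {b, u} (colour_class V c j - {{a, b}})"
            using 2 i(2) by (cases "e = {b, u}"; cases "e = {a, b}") (simp_all add: c'_alt)
        qed
      qed
    next
      case 3
      show ?thesis
      proof (rule cf_colouring_forestI[OF c k], rule subsetI)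
        fix e assume "e \<in> colour_class V c' k"
        then show "e \<in> colour_class V c k"
          using 3 by (cases "e = {b, u}"; cases "e = {a, b}") (simp_all add: c'_alt)
      qed
    qed
  qed (use Dc in simp_all)
  show "flip_equiv V C c c'"
    by (rule flip_equivI[OF c cf, of a b u]) (use D(1-6) u in \<open>auto simp: c'_alt\<close>)
qed

section \<open>Connecting twin stars\<close>

text \<open>Three flips are composed from both ends: \<open>c1\<close> is a pivot of
  \<open>c\<close>, \<open>c2\<close> a pivot of the target \<open>c3\<close> with \<open>a\<close>
  and \<open>b\<close> interchanged, and \<open>c1\<close>, \<open>c2\<close> differ only at
  \<open>{a, v}\<close> and \<open>{b, v}\<close>. The equality of colours keeps the two bijections
  intact.\<close>

lemma twin_star_at_exchange_leaves_aux:
  assumes S: "twin_star_at V C c j a b A B" and u: "u \<in> A" and v: "v \<in> B" and uv: "c {a, v} = c {b, u}"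
  shows "\<exists>c'. twin_star_at V C c' j a b (insert v (A - {u})) (insert u (B - {v})) \<and> flip_equiv V C c c'"
proof -
  note D = twin_star_atD[OF S]
  define i where "i = c {b, u}"
  have ne: "u \<noteq> v" "u \<noteq> a" "u \<noteq> b" "v \<noteq> a" "v \<noteq> b" "a \<noteq> b" "u \<notin> B" "v \<notin> A"
    using D(2-7) u v by auto
  have dis: "{a, u} \<noteq> {b, w}" "w \<noteq> b \<Longrightarrow> {a, w} \<noteq> {b, w'}" "{a, v} \<noteq> {b, w}"
    "{a, b} \<noteq> {a, u}" "{a, b} \<noteq> {a, v}" "{a, b} \<noteq> {b, u}" "{a, b} \<noteq> {b, v}" "{a, u} \<noteq> {a, v}" "{b, u} \<noteq> {b, v}" for w w'
    using ne by (auto simp: doubleton_eq_iff)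
  have eqs: "{a, w} = {a, u} \<longleftrightarrow> w = u" "{a, w} = {a, v} \<longleftrightarrow> w = v"
    "{b, w} = {b, u} \<longleftrightarrow> w = u" "{b, w} = {b, v} \<longleftrightarrow> w = v" for w
    by (auto simp: doubleton_eq_iff)
  note dis' = dis eqs dis[symmetric]
  \<comment> \<open>The target: the four edges joining \<open>a\<close>, \<open>b\<close> to
    \<open>u\<close>, \<open>v\<close> exchange the colours \<open>i\<close> and
    \<open>j\<close>.\<close>
  define c3 where "c3 e = (if e = {a, u} \<or> e = {b, v} then i else if e = {a, v} \<or> e = {b, u} then j else c e)" for e
  have inner: "c3 e = c e" if "e \<in> edges (A \<union> B)" for e
    using that D(3-6) by (auto simp: c3_def)
  have AB: "insert v (A - {u}) \<union> insert u (B - {v}) = A \<union> B"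
    using u v by auto
  have S3: "twin_star_at V C c3 j a b (insert v (A - {u})) (insert u (B - {v}))"
    unfolding twin_star_at_def AB
  proof (intro conjI ballI)
    show "V = insert a (insert b (A \<union> B))" "a \<noteq> b" "a \<notin> A \<union> B" "b \<notin> A \<union> B" "j \<in> C"
      using D(1-8) by simp_all
    show "insert v (A - {u}) \<inter> insert u (B - {v}) = {}"
      using D(7) ne by auto
    show "c3 {a, b} = j"
      using D(9) ne by (simp add: c3_def dis eqs)
    show "c3 {a, w} = j" if "w \<in> insert v (A - {u})" for w
    proof (cases "w = v")
      case False
      then have "w \<noteq> u" "w \<in> A" "w \<noteq> b" using that D(5) by auto
      then show ?thesis using False D(10)[of w] by (simp add: c3_def dis eqs)
    qed (use ne in \<open>simp add: c3_def dis eqs\<close>)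
    show "c3 {b, w} = j" if "w \<in> insert u (B - {v})" for w
    proof (cases "w = u")
      case False
      then have "w \<noteq> v" "w \<in> B" "w \<noteq> a" using that D(4) by auto
      then show ?thesis using False D(11)[of w] by (simp add: c3_def dis')
    qed (use ne in \<open>simp add: c3_def dis'\<close>)
    show "bij_betw (\<lambda>w. c3 {b, w}) (insert v (A - {u})) (C - {j})"
      by (rule bij_betw_replace[OF D(12) u ne(8)]) (use ne in \<open>auto simp: c3_def dis' i_def\<close>)
    show "bij_betw (\<lambda>w. c3 {a, w}) (insert u (B - {v})) (C - {j})"
      by (rule bij_betw_replace[OF D(13) v ne(7)]) (use ne D(6) uv in \<open>auto simp: c3_def dis eqs i_def\<close>)
    show "cf_colouring (A \<union> B) (C - {j}) c3"
      by (rule cf_colouring_cong[OF D(14) inner])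
  qed
  define c1 where "c1 = c({a, b} := c {b, u}, {b, u} := j)"
  define c2 where "c2 = c3({b, a} := c3 {a, u}, {a, u} := j)"
  note P1 = twin_star_at_pivot[OF S u c1_def]
  have "u \<in> insert u (B - {v})" by simp
  note P2 = twin_star_at_pivot[OF twin_star_at_sym[OF S3] this c2_def]
  have "flip_equiv V C c1 c2"
  proof (rule flip_equivI[OF P1(1) P2(1), of a b v])
    fix e
    assume "e \<noteq> {a, b}" "e \<noteq> {a, v}" "e \<noteq> {b, v}"
    then show "c1 e = c2 e"
      using D(10)[OF u] insert_commute[of b a "{}"]
      by (cases "e = {a, u}"; cases "e = {b, u}") (simp_all add: c1_def c2_def c3_def dis')
  qed (use ne v D(1) in simp_all)
  with P1(2) flip_equiv_sym[OF P2(2)] have "flip_equiv V C c c3"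
    by (meson rtranclp_trans)
  with S3 show ?thesis by blast
qed

text \<open>The equality of colours is arranged beforehand: the leaf \<open>v'\<close> whose edge to
  \<open>a\<close> has the colour of \<open>{b, u}\<close> trades colours with
  \<open>v\<close>.\<close>

lemma twin_star_at_exchange_leaves:
  assumes S: "twin_star_at V C c j a b A B" and u: "u \<in> A" and v: "v \<in> B"
  shows "\<exists>c'. twin_star_at V C c' j a b (insert v (A - {u})) (insert u (B - {v})) \<and> flip_equiv V C c c'"
proof -
  note D = twin_star_atD[OF S]
  have "c {b, u} \<in> (\<lambda>v. c {a, v}) ` B"
    using bij_betwE[OF D(12)] bij_betw_imp_surj_on[OF D(13)] u by simp
  then obtain v' where v': "v' \<in> B" "c {a, v'} = c {b, u}" by auto
  show ?thesis
  proof (cases "v' = v")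
    case True
    then show ?thesis using twin_star_at_exchange_leaves_aux[OF S u v] v'(2) by simp
  next
    case False
    define c1 where "c1 = c({a, v} := c {a, v'}, {a, v'} := c {a, v})"
    note c1 = twin_star_at_swap_colours[OF S v v'(1) False[symmetric] c1_def]
    have "{a, v} \<noteq> {a, v'}" "{b, u} \<noteq> {a, v}" "{b, u} \<noteq> {a, v'}"
      using False D(2-7) u v v' by (auto simp: doubleton_eq_iff)
    then have "c1 {a, v} = c1 {b, u}"
      using v'(2) by (simp add: c1_def)
    from twin_star_at_exchange_leaves_aux[OF c1(1) u v this] c1(2) show ?thesis
      by (meson rtranclp_trans)
  qed
qed

text \<open>Each exchange replaces a leaf in \<open>A - A'\<close> by one in \<open>A' - A\<close>,
  until the leaf sets agree.\<close>

lemma twin_star_at_flip_equiv_same_centres: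
  assumes "twin_star_at V C c j a b A B" and S': "twin_star_at V C c' j a b A' B'"
    and IH: "\<And>g h. cf_colouring (V - {a, b}) (C - {j}) g \<Longrightarrow> cf_colouring (V - {a, b}) (C - {j}) h
      \<Longrightarrow> flip_equiv (V - {a, b}) (C - {j}) g h"
  shows "flip_equiv V C c c'"
  using assms(1)
proof (induction "card (A - A')" arbitrary: c A B rule: less_induct)
  case less
  note D = twin_star_atD[OF less.prems] and D' = twin_star_atD[OF S']
  have AB: "A \<union> B = A' \<union> B'"
  proof -
    have "A \<union> B = V - {a, b}" using D(1-6) by auto
    moreover have "A' \<union> B' = V - {a, b}" using D'(1-6) by auto
    ultimately show ?thesis by simp
  qed
  show ?case
  proof (cases "A = A'")
    case True
    then have "B = B'" using AB D(7) D'(7) by auto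
    then show ?thesis
      using twin_star_at_flip_equiv_same_leaves[OF less.prems _ IH] S' True by simp
  next
    case False
    have "card A = card A'" using D(18) D'(18) by simp
    then have "\<not> A \<subseteq> A'" "\<not> A' \<subseteq> A"
      using False D(15) D'(15) card_subset_eq by metis+
    then obtain u v where u: "u \<in> A" "u \<notin> A'" and v: "v \<in> A'" "v \<notin> A" by blast
    have "v \<in> B" using v AB by auto
    then obtain c1 where c1: "twin_star_at V C c1 j a b (insert v (A - {u})) (insert u (B - {v}))"
      "flip_equiv V C c c1"
      using twin_star_at_exchange_leaves[OF less.prems u(1)] by blast
    have "insert v (A - {u}) - A' = A - A' - {u}"
      using v by auto
    then have "card (insert v (A - {u}) - A') < card (A - A')"
      using u D(15) by (metis Diff_iff card_Diff1_less finite_Diff)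
    from less.hyps[OF this c1(1)] c1(2) show ?thesis by (meson rtranclp_trans)
  qed
qed

section \<open>Constructing colourings with prescribed twin stars\<close>

text \<open>Nothing in \<open>twin_star_at\<close> relates the inner colouring to the two
  bijections, so all three can be prescribed independently; the existence proofs below exploit this
  freedom.\<close>

lemma twin_star_at_extend:
  assumes h: "cf_colouring (A \<union> B) (C - {j}) h" and "a \<noteq> b" "a \<notin> A \<union> B" "b \<notin> A \<union> B" "A \<inter> B = {}" "j \<in> C"
    and f: "bij_betw f A (C - {j})" and g: "bij_betw g B (C - {j})"
  obtains c where "twin_star_at (insert a (insert b (A \<union> B))) C c j a b A B"
    "\<And>u. u \<in> A \<Longrightarrow> c {b, u} = f u" "\<And>v. v \<in> B \<Longrightarrow> c {a, v} = g v" "\<And>e. e \<in> edges (A \<union> B) \<Longrightarrow> c e = h e"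
proof -
  \<comment> \<open>A leaf is recovered from its edge by removing the centre; every edge not listed
    gets \<open>j\<close>.\<close>
  define c where "c e = (if e \<in> edges (A \<union> B) then h e
    else if e \<in> (\<lambda>u. {b, u}) ` A then f (the_elem (e - {b}))
    else if e \<in> (\<lambda>v. {a, v}) ` B then g (the_elem (e - {a})) else j)" for e
  have mem: "{b, w} \<in> (\<lambda>u. {b, u}) ` A \<longleftrightarrow> w \<in> A" "{a, w} \<in> (\<lambda>v. {a, v}) ` B \<longleftrightarrow> w \<in> B"
    "{b, w} \<notin> (\<lambda>v. {a, v}) ` B" "{a, w} \<notin> (\<lambda>u. {b, u}) ` A" for w
    using assms(2-4) unfolding image_iff doubleton_eq_iff by auto
  have "{b, u} - {b} = {u}" if "u \<in> A" for u using that assms(4) by auto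
  then have cb: "c {b, u} = f u" if "u \<in> A" for u
    using that assms(4) by (simp add: c_def mem(1))
  have "{a, v} - {a} = {v}" if "v \<in> B" for v using that assms(3) by auto
  then have ca: "c {a, v} = g v" if "v \<in> B" for v
    using that assms(3) by (simp add: c_def mem)
  have ch: "c e = h e" if "e \<in> edges (A \<union> B)" for e
    using that by (simp add: c_def)
  have "cf_colouring (A \<union> B) (C - {j}) c"
    by (rule cf_colouring_cong[OF h ch])
  moreover have "c {a, u} = j" if "u \<in> A" for u
  proof -
    have "u \<notin> B" using that assms(5) by auto
    then show ?thesis using assms(3) by (simp add: c_def mem)
  qed
  moreover have "c {b, v} = j" if "v \<in> B" for v
  proof -
    have "v \<notin> A" using that assms(5) by auto
    then show ?thesis using assms(4) by (simp add: c_def mem)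
  qed
  moreover have "b \<notin> B" using assms(4) by simp
  then have "c {a, b} = j" using assms(3) by (simp add: c_def mem)
  moreover have "bij_betw (\<lambda>u. c {b, u}) A (C - {j})" "bij_betw (\<lambda>v. c {a, v}) B (C - {j})"
    using f g by (simp_all add: ca cb cong: bij_betw_cong)
  ultimately have "twin_star_at (insert a (insert b (A \<union> B))) C c j a b A B"
    unfolding twin_star_at_def using assms(2-6) by simp
  from that[OF this cb ca ch] show thesis .
qed

lemma bij_betw_with_value:
  assumes "finite A" "finite T" "card A = card T" "y \<in> A" "i \<in> T"
  obtains f where "bij_betw f A T" "f y = i"
proof -
  obtain f where f: "bij_betw f A T"
    using finite_same_card_bij assms(1-3) by blast
  have "bij_betw (Transposition.transpose (f y) i) T T"
    using bij_betwE[OF f] assms(4,5) permutes_imp_bij[OF permutes_swap_id] by metis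
  then have "bij_betw (Transposition.transpose (f y) i \<circ> f) A T"
    using f bij_betw_trans by blast
  moreover have "(Transposition.transpose (f y) i \<circ> f) y = i" by simp
  ultimately show thesis by (rule that)
qed

text \<open>Without the centres and the colour \<open>j\<close> there remain two vertices and one
  colour fewer, so induction supplies the inner colouring; the split into leaf sets and the
  bijections are arbitrary.\<close>

lemma twin_star_at_exists:
  assumes "finite V" "finite C" "card V = 2 * card C" "j \<in> C" "a \<in> V" "b \<in> V" "a \<noteq> b"
  shows "\<exists>c A B. twin_star_at V C c j a b A B"
  using assms
proof (induction "card C" arbitrary: V C j a b)
  case 0
  then show ?case by simp
next
  case (Suc n)
  define W where "W = V - {a, b}"
  have V: "V = insert a (insert b W)" "a \<notin> W" "b \<notin> W" using Suc.prems by (auto simp: W_def)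
  have finW: "finite W" using Suc.prems(1) by (simp add: W_def)
  have cardW: "card W = 2 * n"
    using Suc.hyps(2) Suc.prems V finW by simp
  have cardC: "card (C - {j}) = n"
    using Suc.hyps(2) Suc.prems(2,4) by simp
  have "\<exists>h. cf_colouring W (C - {j}) h"
  proof (cases "n = 0")
    case True
    then have "W = {}" "C - {j} = {}" using cardW cardC finW Suc.prems(2) by simp_all
    \<comment> \<open>Without vertices every function will do; \<open>j\<close> is a mere default
      value.\<close>
    then have "cf_colouring W (C - {j}) (\<lambda>_. j)"
      using cardC \<open>n = 0\<close> Suc.prems(2) unfolding cf_colouring_def
      by (auto simp: edges_def colour_class_def)
    then show ?thesis by (rule exI[of _ "\<lambda>_. j"])
  next
    case False
    then obtain j' where j': "j' \<in> C - {j}"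
      using cardC by (metis card.empty equals0I)
    have "2 \<le> card W" using False cardW by simp
    then obtain T where "T \<subseteq> W" "card T = 2" by (meson obtain_subset_with_card_n)
    then obtain a' b' where "a' \<in> W" "b' \<in> W" "a' \<noteq> b'" by (auto simp: card_2_iff)
    then obtain h A B where "twin_star_at W (C - {j}) h j' a' b' A B"
      using Suc.hyps(1)[of "C - {j}" W j' a' b'] cardC cardW finW Suc.prems(2) j' by auto
    then have "cf_colouring W (C - {j}) h" by (rule twin_star_at_cf_colouring)
    then show ?thesis by (rule exI[of _ h])
  qed
  then obtain h where h: "cf_colouring W (C - {j}) h" ..
  have "n \<le> card W" using cardW by simp
  then obtain A where A: "A \<subseteq> W" "card A = n" "finite A" by (meson obtain_subset_with_card_n)
  have "card (W - A) = n" using A cardW by (simp add: card_Diff_subset)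
  then obtain f g where "bij_betw f A (C - {j})" "bij_betw g (W - A) (C - {j})"
    using A finW cardC Suc.prems(2) by (metis finite_Diff finite_same_card_bij)
  moreover have AW: "A \<union> (W - A) = W" using A by auto
  ultimately obtain c where "twin_star_at (insert a (insert b (A \<union> (W - A)))) C c j a b A (W - A)"
    using twin_star_at_extend[of A "W - A" C j h a b f g] h V(2,3) Suc.prems(4,7) Diff_disjoint
    unfolding AW by metis
  then show ?case
    unfolding AW V(1) by blast
qed

text \<open>The inner colouring is given a twin star of colour \<open>i\<close> centred at
  \<open>x\<close>, \<open>y\<close>. With \<open>y\<close> among the leaves of \<open>a\<close> and
  \<open>x\<close> among those of \<open>b\<close>, the edges \<open>{a, x}\<close> and
  \<open>{b, y}\<close> may receive colour \<open>i\<close>, so that \<open>a\<close> becomes a leaf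
  of \<open>x\<close> and \<open>b\<close> a leaf of \<open>y\<close>.\<close>

lemma two_twin_stars_exist:
  assumes "finite V" "finite C" "card V = 2 * card C" and ij: "i \<in> C" "j \<in> C" "i \<noteq> j"
    and V: "{a, b, x, y} \<subseteq> V" "distinct [a, b, x, y]"
  obtains c A B A' B' where "twin_star_at V C c j a b A B" "twin_star_at V C c i x y A' B'"
proof -
  define W where "W = V - {a, b}"
  have W: "V = insert a (insert b W)" "a \<notin> W" "b \<notin> W" "x \<in> W" "y \<in> W" "a \<noteq> b" "x \<noteq> y"
    using V by (auto simp: W_def)
  have finW: "finite W" using assms(1) by (simp add: W_def)
  have cardC: "card (C - {j}) = card C - 1" "card C \<ge> 2"
  proof -
    show "card (C - {j}) = card C - 1" using ij by simp
    have "card {i, j} \<le> card C" using ij assms(2) by (intro card_mono) auto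
    then show "card C \<ge> 2" using ij(3) by simp
  qed
  have cardW: "card W = 2 * card (C - {j})"
    using assms(3) finW W cardC by simp
  obtain h A2 B2 where h: "twin_star_at W (C - {j}) h i x y A2 B2"
    using twin_star_at_exists[OF finW _ cardW _ W(4,5,7), of i] ij assms(2) by auto
  note Dh = twin_star_atD[OF h]
  have "card (C - {j}) - 1 \<le> card (W - {x, y})"
    using cardW finW W by (simp add: card_Diff_subset)
  then obtain A0 where A0: "A0 \<subseteq> W - {x, y}" "card A0 = card (C - {j}) - 1" "finite A0"
    by (meson obtain_subset_with_card_n)
  define A where "A = insert y A0"
  define B where "B = W - A"
  have AB: "W = A \<union> B" "A \<inter> B = {}" "y \<in> A" "x \<in> B" "finite A" "finite B"
    using A0 W finW by (auto simp: A_def B_def)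
  have "y \<notin> A0" using A0 by auto
  then have "card A = card (C - {j})" using A0 cardC by (simp add: A_def)
  moreover from this have "card B = card (C - {j})"
    using cardW card_Un_disjoint[OF AB(5,6,2)] AB(1) by simp
  ultimately obtain f g where f: "bij_betw f A (C - {j})" "f y = i" and g: "bij_betw g B (C - {j})" "g x = i"
    using bij_betw_with_value AB(3-6) assms(2) ij by (metis DiffI finite_Diff singletonD)
  have "cf_colouring (A \<union> B) (C - {j}) h"
    using twin_star_at_cf_colouring[OF h] AB(1) by simp
  from twin_star_at_extend[OF this W(6) _ _ AB(2) ij(2) f(1) g(1)] W(1-3)
  obtain c where c: "twin_star_at V C c j a b A B" "\<And>u. u \<in> A \<Longrightarrow> c {b, u} = f u"
    "\<And>v. v \<in> B \<Longrightarrow> c {a, v} = g v" "\<And>e. e \<in> edges W \<Longrightarrow> c e = h e"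
    unfolding AB(1) by blast
  have "twin_star_at V C c i x y (insert a A2) (insert b B2)"
  proof (rule twin_star_atI[OF twin_star_at_cf_colouring[OF c(1)] ij(1)])
    show "V = insert x (insert y (insert a A2 \<union> insert b B2))"
      using W(1) Dh(1) by auto
    show "x \<noteq> y" "x \<notin> insert a A2 \<union> insert b B2" "y \<notin> insert a A2 \<union> insert b B2"
      "insert a A2 \<inter> insert b B2 = {}"
      using W Dh(1-7) by auto
    have "a \<notin> A2" "b \<notin> B2" using W(2,3) Dh(1) by auto
    then show "card (insert a A2) = card (insert b B2)"
      using Dh(15,16,18,19) by simp
    show "c {x, y} = i" using c(4) W Dh(9) by simp
    show "c {x, u} = i" if "u \<in> insert a A2" for u
    proof (cases "u = a")
      case True
      then show ?thesis using c(3)[OF AB(4)] g(2) by (simp add: insert_commute)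
    next
      case False
      then have "u \<in> A2" "u \<in> W" "u \<noteq> x" using that Dh(1,3) by auto
      then show ?thesis using c(4)[of "{x, u}"] W(4) Dh(10)[of u] by simp
    qed
    show "c {y, v} = i" if "v \<in> insert b B2" for v
    proof (cases "v = b")
      case True
      then show ?thesis using c(2)[OF AB(3)] f(2) by (simp add: insert_commute)
    next
      case False
      then have "v \<in> B2" "v \<in> W" "v \<noteq> y" using that Dh(1,6) by auto
      then show ?thesis using c(4)[of "{y, v}"] W(5) Dh(11)[of v] by simp
    qed
  qed
  with c(1) show thesis by (rule that)
qed

section \<open>Changing the colour and the centres of the twin star\<close>

text \<open>The intermediate \<open>d\<close> carries both twin stars: from \<open>c\<close> to
  \<open>d\<close> the data \<open>j\<close>, \<open>a\<close>, \<open>b\<close> are kept, from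
  \<open>d\<close> to \<open>c'\<close> the data \<open>i\<close>, \<open>x\<close>,
  \<open>y\<close>. The induction hypothesis serves \<open>C - {j}\<close> and
  \<open>C - {i}\<close>.\<close>

lemma twin_star_at_flip_equiv_disjoint_centres:
  fixes V :: "'v set" and C :: "'c set"
  assumes S: "twin_star_at V C c j a b A B" and S': "twin_star_at V C c' i x y A' B'"
    and ij: "j \<noteq> i" and dis: "distinct [a, b, x, y]"
    and IH: "\<And>(W :: 'v set) (D :: 'c set) g h. card D < card C \<Longrightarrow> cf_colouring W D g \<Longrightarrow> cf_colouring W D h
      \<Longrightarrow> flip_equiv W D g h"
  shows "flip_equiv V C c c'"
proof -
  note c = cf_colouringD[OF twin_star_at_cf_colouring[OF S]]
  note D = twin_star_atD[OF S] and D' = twin_star_atD[OF S']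
  have V: "{a, b, x, y} \<subseteq> V" using D(1) D'(1) by auto
  obtain d A1 B1 A2 B2 where d: "twin_star_at V C d j a b A1 B1" "twin_star_at V C d i x y A2 B2"
    using two_twin_stars_exist[OF c(1-3) D'(8) D(8) ij[symmetric] V dis] .
  have less: "card (C - {j}) < card C" "card (C - {i}) < card C"
    using card_Diff1_less[OF c(2)] D(8) D'(8) by blast+
  have "flip_equiv V C c d"
    by (rule twin_star_at_flip_equiv_same_centres[OF S d(1) IH[OF less(1)]])
  moreover have "flip_equiv V C d c'"
    by (rule twin_star_at_flip_equiv_same_centres[OF d(2) S' IH[OF less(2)]])
  ultimately show ?thesis by (rule rtranclp_trans)
qed

text \<open>With two colours class \<open>j\<close> is a path \<open>w a b v\<close>; the pivot at
  \<open>w\<close> replaces \<open>{a, b}\<close> by \<open>{b, w}\<close> and yields the path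
  \<open>a w b v\<close>.\<close>

lemma twin_star_at_move_centre_leaf:
  assumes S: "twin_star_at V C c j a b A B" and C2: "card C = 2" and w: "w \<in> A"
  shows "\<exists>c' A' B'. twin_star_at V C c' j w b A' B' \<and> flip_equiv V C c c'"
proof -
  note D = twin_star_atD[OF S]
  have "card A = 1" "card B = 1" using D(18,19) C2 by simp_all
  then obtain v where v: "A = {w}" "B = {v}" using w by (auto simp: card_1_singleton_iff)
  define c' where "c' = c({a, b} := c {b, w}, {b, w} := j)"
  note c' = twin_star_at_pivot[OF S w c'_def]
  have ne: "{w, a} \<noteq> {a, b}" "{w, a} \<noteq> {b, w}" "{b, v} \<noteq> {a, b}" "{b, v} \<noteq> {b, w}"
    using D(2-7) v by (auto simp: doubleton_eq_iff)
  have "twin_star_at V C c' j w b {a} {v}"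
  proof (rule twin_star_atI[OF c'(1) D(8)])
    show "c' {w, b} = j" by (simp add: c'_def insert_commute)
    show "c' {w, u} = j" if "u \<in> {a}" for u
      using that ne D(10)[OF w] insert_commute[of w a "{}"] by (simp add: c'_def)
    show "c' {b, u} = j" if "u \<in> {v}" for u
      using that ne D(11)[of v] v by (simp add: c'_def)
  qed (use D(1-7) v in auto)
  then show ?thesis using c'(2) by blast
qed

text \<open>A leaf of \<open>b\<close> is first made a leaf of \<open>a\<close>, so that the
  preceding move applies.\<close>

lemma twin_star_at_move_centre:
  assumes S: "twin_star_at V C c j a b A B" and C2: "card C = 2" and w: "w \<in> V" "w \<noteq> b"
  shows "\<exists>c' A' B'. twin_star_at V C c' j w b A' B' \<and> flip_equiv V C c c'"
proof -
  note D = twin_star_atD[OF S]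
  have "w \<in> {a} \<union> A \<union> B" using w D(1) by auto
  then consider "w = a" | "w \<in> A" | "w \<in> B" by blast
  then show ?thesis
  proof cases
    case 1
    with S show ?thesis by blast
  next
    case 2
    then show ?thesis by (rule twin_star_at_move_centre_leaf[OF S C2])
  next
    case 3
    have "A \<noteq> {}" using D(18) C2 by auto
    then obtain u where "u \<in> A" by blast
    then obtain c1 where c1: "twin_star_at V C c1 j a b (insert w (A - {u})) (insert u (B - {w}))"
      "flip_equiv V C c c1"
      using twin_star_at_exchange_leaves[OF S _ 3] by blast
    have "w \<in> insert w (A - {u})" by simp
    from twin_star_at_move_centre_leaf[OF c1(1) C2 this] c1(2) show ?thesis
      by (meson rtranclp_trans)
  qed
qed

lemma twin_star_at_flip_equiv_same_colour:
  fixes V :: "'v set" and C :: "'c set"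
  assumes S: "twin_star_at V C c j a b A B" and S': "twin_star_at V C c' j x y A' B'" and C2: "card C = 2"
    and IH: "\<And>(W :: 'v set) (D :: 'c set) g h. card D < card C \<Longrightarrow> cf_colouring W D g \<Longrightarrow> cf_colouring W D h
      \<Longrightarrow> flip_equiv W D g h"
  shows "flip_equiv V C c c'"
proof -
  note D = twin_star_atD[OF S] and D' = twin_star_atD[OF S']
  have xy: "x \<in> V" "y \<in> V" "x \<noteq> y" using D' by simp_all
  have "\<exists>d A B. twin_star_at V C d j x y A B \<and> flip_equiv V C c d"
  \<comment> \<open>The centres move one at a time, and none can move onto the other. If
    \<open>x = b\<close>, only \<open>a\<close> has to move, namely to \<open>y\<close>.\<close>
  proof (cases "x = b")
    case True
    then obtain d A1 B1 where d: "twin_star_at V C d j y x A1 B1" "flip_equiv V C c d"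
      using twin_star_at_move_centre[OF S C2 xy(2)] xy(3) by blast
    from twin_star_at_sym[OF d(1)] d(2) show ?thesis by blast
  next
    case False
    then obtain d A1 B1 where d: "twin_star_at V C d j x b A1 B1" "flip_equiv V C c d"
      using twin_star_at_move_centre[OF S C2 xy(1)] by blast
    obtain d' A2 B2 where d': "twin_star_at V C d' j y x A2 B2" "flip_equiv V C d d'"
      using twin_star_at_move_centre[OF twin_star_at_sym[OF d(1)] C2 xy(2)] xy(3) by metis
    from twin_star_at_sym[OF d'(1)] d(2) d'(2) show ?thesis by (meson rtranclp_trans)
  qed
  then obtain d A1 B1 where d: "twin_star_at V C d j x y A1 B1" "flip_equiv V C c d" by blast
  have "flip_equiv V C d c'"
    by (rule twin_star_at_flip_equiv_same_centres[OF d(1) S' IH[OF card_Diff1_less[OF D(17,8)]]])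
  with d(2) show ?thesis by (rule rtranclp_trans)
qed

text \<open>Three or more colours leave room for a third colour and two vertices avoiding all given
  centres, hence for a common neighbour of both colourings. With two colours and four vertices, the
  colour is changed by passing to the pair complementary to \<open>a\<close>, \<open>b\<close>, and
  the centres are then moved within one colour.\<close>

lemma twin_star_at_flip_equiv:
  fixes V :: "'v set" and C :: "'c set"
  assumes S: "twin_star_at V C c j a b A B" and S': "twin_star_at V C c' j' a' b' A' B'"
    and C2: "card C \<ge> 2"
    and IH: "\<And>(W :: 'v set) (D :: 'c set) g h. card D < card C \<Longrightarrow> cf_colouring W D g \<Longrightarrow> cf_colouring W D h
      \<Longrightarrow> flip_equiv W D g h"
  shows "flip_equiv V C c c'"
proof -
  note c = cf_colouringD[OF twin_star_at_cf_colouring[OF S]]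
  note D = twin_star_atD[OF S] and D' = twin_star_atD[OF S']
  have V: "a \<in> V" "b \<in> V" using D(1) by simp_all
  have V': "a' \<in> V" "b' \<in> V" using D'(1) by simp_all
  have pair: "\<exists>x y. x \<in> V - T \<and> y \<in> V - T \<and> x \<noteq> y" if "finite T" "card T + 2 \<le> card V" for T
  proof -
    have "2 \<le> card (V - T)" using that diff_card_le_card_Diff[of T V] by linarith
    then obtain U where "U \<subseteq> V - T" "card U = 2" by (meson obtain_subset_with_card_n)
    then show ?thesis by (auto simp: card_2_iff)
  qed
  show ?thesis
  proof (cases "card C = 2")
    case True
    show ?thesis
    proof (cases "j = j'")
      case True
      then show ?thesis
        using twin_star_at_flip_equiv_same_colour[OF S _ \<open>card C = 2\<close> IH] S' by blast
    next
      case False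
      have "card {a, b} + 2 \<le> card V" using D(2) c(3) \<open>card C = 2\<close> by simp
      then obtain x y where xy: "x \<in> V - {a, b}" "y \<in> V - {a, b}" "x \<noteq> y"
        using pair[of "{a, b}"] by auto
      then have dis: "distinct [a, b, x, y]" "{a, b, x, y} \<subseteq> V" using D(2) V by auto
      obtain d A1 B1 A2 B2 where d: "twin_star_at V C d j a b A1 B1" "twin_star_at V C d j' x y A2 B2"
        using two_twin_stars_exist[OF c(1-3) D'(8) D(8) _ dis(2,1)] False by metis
      have "flip_equiv V C c d"
        using twin_star_at_flip_equiv_disjoint_centres[OF S d(2) False dis(1) IH] by blast
      moreover have "flip_equiv V C d c'"
        using twin_star_at_flip_equiv_same_colour[OF d(2) S' True IH] by blast
      ultimately show ?thesis by (rule rtranclp_trans)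
    qed
  next
    case False
    \<comment> \<open>There are at least six vertices, so two lie outside the given centres.\<close>
    have "card {a, b, a', b'} \<le> 4"
      by (auto simp: card_insert_if)
    then obtain x y where xy: "x \<in> V - {a, b, a', b'}" "y \<in> V - {a, b, a', b'}" "x \<noteq> y"
      using pair[of "{a, b, a', b'}"] c(3) C2 False by auto
    have "\<not> C \<subseteq> {j, j'}"
      using card_mono[of "{j, j'}" C] C2 False by (auto simp: card_insert_if split: if_splits)
    then obtain i where i: "i \<in> C" "j \<noteq> i" "j' \<noteq> i" by blast
    obtain d A1 B1 where d: "twin_star_at V C d i x y A1 B1"
      using twin_star_at_exists[OF c(1-3) i(1)] xy by blast
    have "flip_equiv V C c d"
      using xy D(2) by (intro twin_star_at_flip_equiv_disjoint_centres[OF S d i(2) _ IH]) auto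
    moreover have "flip_equiv V C c' d"
      using xy D'(2) by (intro twin_star_at_flip_equiv_disjoint_centres[OF S' d i(3) _ IH]) auto
    ultimately show ?thesis
      by (meson flip_equiv_sym rtranclp_trans)
  qed
qed

text \<open>Stated for all vertex and colour sets at once, because removing the centres of a twin star
  leaves no initial segment of the natural numbers.\<close>

lemma cf_colourings_flip_equiv:
  assumes ts: "\<And>(V :: 'v set) (C :: 'c set) c. card C \<le> d \<Longrightarrow> card C \<ge> 1 \<Longrightarrow> cf_colouring V C c
      \<Longrightarrow> \<exists>c' j a b A B. flip_equiv V C c c' \<and> twin_star_at V C c' j a b A B"
    and "cf_colouring (V :: 'v set) (C :: 'c set) c" "cf_colouring V C c'" "card C \<le> d"
  shows "flip_equiv V C c c'"
  using assms(2-4)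
proof (induction "card C" arbitrary: V C c c' rule: less_induct)
  case less
  note D = cf_colouringD[OF less.prems(1)] cf_colouringD[OF less.prems(2)]
  show ?case
  proof (cases "card C \<le> 1")
    case True
    \<comment> \<open>A single colour leaves no choice, and without colours there are no
      edges.\<close>
    have "c e = c' e" if "e \<in> edges V" for e
      using D(4,9)[OF that] True card_le_Suc0_iff_eq[OF D(2)] by auto
    then show ?thesis by (rule flip_equiv_eqI[OF less.prems(1)])
  next
    case False
    then have C: "card C \<ge> 1" "card C \<ge> 2" by simp_all
    obtain g j a b A B where g: "flip_equiv V C c g" "twin_star_at V C g j a b A B"
      using ts[OF less.prems(3) C(1) less.prems(1)] by blast
    obtain h j' a' b' A' B' where h: "flip_equiv V C c' h" "twin_star_at V C h j' a' b' A' B'"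
      using ts[OF less.prems(3) C(1) less.prems(2)] by blast
    have "flip_equiv V C g h"
      using less.hyps less.prems(3)
      by (intro twin_star_at_flip_equiv[OF g(2) h(2) C(2)]) auto
    with g(1) flip_equiv_sym[OF h(1)] show ?thesis by (meson rtranclp_trans)
  qed
qed

section \<open>Partitions and colourings\<close>

lemma conn_image: "(x, y) \<in> conn E \<Longrightarrow> (f x, f y) \<in> conn ((`) f ` E)"
  unfolding conn_def[of E]
proof (induction rule: rtrancl_induct)
  case (step y z)
  then have "f ` {y, z} \<in> (`) f ` E" by blast
  then have "(f y, f z) \<in> conn ((`) f ` E)" by (intro conn_edge) simp
  with step.IH show ?case by (rule conn_trans)
qed simp

text \<open>Connectivity is carried along \<open>f\<close> and back along
  \<open>inv_into V f\<close>; injectivity on \<open>V\<close> keeps the removed edge apart from the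
  others.\<close>

lemma forest_image_iff:
  assumes inj: "inj_on f V" and E: "E \<subseteq> edges V"
  shows "forest ((`) f ` E) \<longleftrightarrow> forest E"
proof
  have EV: "e \<subseteq> V" if "e \<in> E" for e using that E by (auto simp: edges_def)
  {
    assume F: "forest ((`) f ` E)"
    show "forest E"
      unfolding forest_def
    proof (intro allI impI notI)
      fix x y assume xy: "{x, y} \<in> E" "(x, y) \<in> conn (E - {{x, y}})"
      have "(`) f ` (E - {{x, y}}) \<subseteq> (`) f ` E - {f ` {x, y}}"
        using inj_on_image_eq_iff[OF inj EV EV[OF xy(1)]] by blast
      then have "(f x, f y) \<in> conn ((`) f ` E - {{f x, f y}})"
        using conn_mono[OF conn_image[OF xy(2), of f]] by simp
      moreover have "f ` {x, y} \<in> (`) f ` E" using xy(1) by (rule imageI)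
      then have "{f x, f y} \<in> (`) f ` E" by simp
      ultimately show False using F by (simp add: forest_def)
    qed
  next
    assume F: "forest E"
    define g where "g = inv_into V f"
    have gf: "g ` f ` e = e" if "e \<in> E" for e
      using EV[OF that] inj by (simp add: g_def inv_into_image_cancel)
    show "forest ((`) f ` E)"
      unfolding forest_def
    proof (intro allI impI notI)
      fix u v assume uv: "{u, v} \<in> (`) f ` E" "(u, v) \<in> conn ((`) f ` E - {{u, v}})"
      then obtain e where e: "e \<in> E" "{u, v} = f ` e" by blast
      have ge: "{g u, g v} = e" using gf[OF e(1)] unfolding e(2)[symmetric] by simp
      have "(`) g ` ((`) f ` E - {{u, v}}) \<subseteq> E - {{g u, g v}}"
        using gf e ge by auto
      then have "(g u, g v) \<in> conn (E - {{g u, g v}})"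
        using conn_mono[OF conn_image[OF uv(2), of g]] by simp
      then show False using F e(1) ge by (auto simp: forest_def)
    qed
  }
qed

text \<open>\<open>\<alpha>\<close> names the vertices and \<open>\<beta>\<close> the colours.
  Keeping both as parameters lets the group action be absorbed into them while the colouring stays;
  see \<open>represents_act\<close>.\<close>

definition represents ::
  "nat \<Rightarrow> (nat \<Rightarrow> 'v) \<Rightarrow> (nat \<Rightarrow> 'c) \<Rightarrow> (nat \<Rightarrow> nat set set) \<Rightarrow> ('v set \<Rightarrow> 'c) \<Rightarrow> bool" where
  "represents d \<alpha> \<beta> \<Gamma> c \<longleftrightarrow> (\<forall>i\<in>{1..d}. \<Gamma> i = {e \<in> edges {1..2 * d}. c (\<alpha> ` e) = \<beta> i})"

lemma representsD:
  "represents d \<alpha> \<beta> \<Gamma> c \<Longrightarrow> i \<in> {1..d} \<Longrightarrow> e \<in> \<Gamma> i \<longleftrightarrow> e \<in> edges {1..2 * d} \<and> c (\<alpha> ` e) = \<beta> i"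
  by (simp add: represents_def)

lemma edges_image:
  assumes "bij_betw f V W"
  shows "edges W = (`) f ` edges V"
proof (rule set_eqI)
  fix e
  have inj: "inj_on f V" and im: "f ` V = W" using assms by (auto simp: bij_betw_def)
  show "e \<in> edges W \<longleftrightarrow> e \<in> (`) f ` edges V"
  proof
    assume "e \<in> edges W"
    then obtain x y where xy: "e = {f x, f y}" "x \<in> V" "y \<in> V" "f x \<noteq> f y"
      using im by (auto elim!: edgesE)
    then have "{x, y} \<in> edges V" by auto
    then have "f ` {x, y} \<in> (`) f ` edges V" by (rule imageI)
    then show "e \<in> (`) f ` edges V" using xy(1) by simp
  next
    assume "e \<in> (`) f ` edges V"
    then obtain e' where "e' \<in> edges V" "e = f ` e'" by blast
    then show "e \<in> edges W"
      using im card_image[OF inj_on_subset[OF inj, of e']] by (auto simp: edges_def)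
  qed
qed

lemma cf_partitions_iff:
  "\<Gamma> \<in> cf_partitions d \<longleftrightarrow> \<Gamma> \<in> extensional {1..d} \<and> (\<forall>i\<in>{1..d}. \<Gamma> i \<subseteq> edges {1..2 * d} \<and> forest (\<Gamma> i))
     \<and> disjoint_family_on \<Gamma> {1..d} \<and> (\<Union>i\<in>{1..d}. \<Gamma> i) = edges {1..2 * d}"
proof -
  have "\<not> has_cycle (\<Gamma> i) \<longleftrightarrow> forest (\<Gamma> i)" if "\<Gamma> i \<subseteq> edges {1..2 * d}" for i
    using has_cycle_iff_not_forest[OF that] by simp
  then show ?thesis
    unfolding cf_partitions_def partitions_def complete_edges_eq PiE_iff by auto
qed

context
  fixes d :: nat and V :: "'v set" and C :: "'c set" and \<alpha> :: "nat \<Rightarrow> 'v" and \<beta> :: "nat \<Rightarrow> 'c"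
  assumes \<alpha>: "bij_betw \<alpha> {1..2 * d} V" and \<beta>: "bij_betw \<beta> {1..d} C"
begin

lemma represents_colour_class:
  assumes "represents d \<alpha> \<beta> \<Gamma> c" "i \<in> {1..d}"
  shows "colour_class V c (\<beta> i) = (`) \<alpha> ` \<Gamma> i"
  using representsD[OF assms] by (auto simp: colour_class_def edges_image[OF \<alpha>])

lemma represents_cf_colouring:
  assumes \<Gamma>: "\<Gamma> \<in> cf_partitions d" and r: "represents d \<alpha> \<beta> \<Gamma> c"
  shows "cf_colouring V C c"
  unfolding cf_colouring_def
proof (intro conjI ballI Pi_I)
  show "finite V" "finite C"
    using \<alpha> \<beta> bij_betw_finite finite_atLeastAtMost by metis+
  show "card V = 2 * card C"
    using bij_betw_same_card[OF \<alpha>] bij_betw_same_card[OF \<beta>] by simp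
  fix e assume "e \<in> edges V"
  then obtain e' where e': "e' \<in> edges {1..2 * d}" "e = \<alpha> ` e'"
    using edges_image[OF \<alpha>] by blast
  then have "e' \<in> (\<Union>i\<in>{1..d}. \<Gamma> i)" using \<Gamma> by (simp add: cf_partitions_iff)
  then obtain i where i: "i \<in> {1..d}" "e' \<in> \<Gamma> i" by blast
  then show "c e \<in> C"
    using representsD[OF r i(1)] bij_betwE[OF \<beta>] e'(2) by simp
next
  fix k assume "k \<in> C"
  then obtain i where i: "i \<in> {1..d}" "k = \<beta> i"
    using bij_betw_imp_surj_on[OF \<beta>] by blast
  have "\<Gamma> i \<subseteq> edges {1..2 * d}" "forest (\<Gamma> i)"
    using \<Gamma> i(1) by (simp_all add: cf_partitions_iff)
  then show "forest (colour_class V c k)"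
    unfolding i(2) represents_colour_class[OF r i(1)]
    using forest_image_iff[OF bij_betw_imp_inj_on[OF \<alpha>]] by blast
qed

lemma represents_exists_partition:
  assumes c: "cf_colouring V C c"
  shows "\<exists>\<Gamma> \<in> cf_partitions d. represents d \<alpha> \<beta> \<Gamma> c"
proof
  define \<Gamma> where "\<Gamma> = (\<lambda>i\<in>{1..d}. {e \<in> edges {1..2 * d}. c (\<alpha> ` e) = \<beta> i})"
  show r: "represents d \<alpha> \<beta> \<Gamma> c"
    by (simp add: represents_def \<Gamma>_def)
  have "forest (\<Gamma> i)" if "i \<in> {1..d}" for i
  proof -
    have "forest (colour_class V c (\<beta> i))"
      using cf_colouringD(5)[OF c] bij_betwE[OF \<beta>] that by blast
    moreover have "\<Gamma> i \<subseteq> edges {1..2 * d}" using that by (auto simp: \<Gamma>_def)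
    ultimately show ?thesis
      unfolding represents_colour_class[OF r that]
      using forest_image_iff[OF bij_betw_imp_inj_on[OF \<alpha>]] by blast
  qed
  moreover have "disjoint_family_on \<Gamma> {1..d}"
    using inj_onD[OF bij_betw_imp_inj_on[OF \<beta>]] by (auto simp: disjoint_family_on_def \<Gamma>_def)
  moreover have "\<exists>i\<in>{1..d}. e \<in> \<Gamma> i" if e: "e \<in> edges {1..2 * d}" for e
  proof -
    have "\<alpha> ` e \<in> edges V" using e edges_image[OF \<alpha>] by blast
    then have "c (\<alpha> ` e) \<in> \<beta> ` {1..d}"
      using cf_colouringD(4)[OF c] bij_betw_imp_surj_on[OF \<beta>] by simp
    then show ?thesis using e by (auto simp: \<Gamma>_def)
  qed
  moreover have "\<Gamma> i \<subseteq> edges {1..2 * d}" if "i \<in> {1..d}" for i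
    using that by (auto simp: \<Gamma>_def)
  moreover have "\<Gamma> \<in> extensional {1..d}" by (simp add: \<Gamma>_def)
  ultimately show "\<Gamma> \<in> cf_partitions d"
    unfolding cf_partitions_iff by blast
qed

lemma represents_exists_colouring:
  assumes \<Gamma>: "\<Gamma> \<in> cf_partitions d"
  shows "\<exists>c. represents d \<alpha> \<beta> \<Gamma> c"
proof
  define g where "g = inv_into {1..2 * d} \<alpha>"
  \<comment> \<open>The parts are disjoint and cover all edges, so the index is unique for images of
    edges; elsewhere the value is arbitrary.\<close>
  define c where "c e = \<beta> (THE i. i \<in> {1..d} \<and> g ` e \<in> \<Gamma> i)" for e
  have g: "g ` \<alpha> ` e = e" if "e \<in> edges {1..2 * d}" for e
    using that bij_betw_imp_inj_on[OF \<alpha>] by (simp add: g_def edges_def inv_into_image_cancel)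
  have c: "c (\<alpha> ` e) = \<beta> i" if "i \<in> {1..d}" "e \<in> \<Gamma> i" for i e
  proof -
    have "e \<in> edges {1..2 * d}" using \<Gamma> that unfolding cf_partitions_iff by blast
    moreover have "(THE i. i \<in> {1..d} \<and> e \<in> \<Gamma> i) = i"
      using \<Gamma> that unfolding cf_partitions_iff disjoint_family_on_def by (intro the_equality) blast+
    ultimately show ?thesis by (simp add: c_def g)
  qed
  show "represents d \<alpha> \<beta> \<Gamma> c"
    unfolding represents_def
  proof (intro ballI set_eqI iffI)
    fix i e assume i: "i \<in> {1..d}" and "e \<in> \<Gamma> i"
    then show "e \<in> {e \<in> edges {1..2 * d}. c (\<alpha> ` e) = \<beta> i}"
      using \<Gamma> c unfolding cf_partitions_iff by blast
  next
    fix i e assume i: "i \<in> {1..d}" and e: "e \<in> {e \<in> edges {1..2 * d}. c (\<alpha> ` e) = \<beta> i}"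
    then have "e \<in> (\<Union>i\<in>{1..d}. \<Gamma> i)" using \<Gamma> by (simp add: cf_partitions_iff)
    then obtain k where k: "k \<in> {1..d}" "e \<in> \<Gamma> k" by blast
    then have "\<beta> k = \<beta> i" using c e by simp
    then have "k = i" using inj_onD[OF bij_betw_imp_inj_on[OF \<beta>]] i k(1) by blast
    then show "e \<in> \<Gamma> i" using k by simp
  qed
qed

lemma represents_coincide_iff:
  assumes P: "P \<in> cf_partitions d" "represents d \<alpha> \<beta> P c" and Q: "represents d \<alpha> \<beta> Q c'"
    and e: "e \<in> edges {1..2 * d}"
  shows "coincide_at d P Q e \<longleftrightarrow> c (\<alpha> ` e) = c' (\<alpha> ` e)"
proof
  assume "coincide_at d P Q e"
  then show "c (\<alpha> ` e) = c' (\<alpha> ` e)"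
    using representsD[OF P(2)] representsD[OF Q] by (auto simp: coincide_at_def)
next
  assume eq: "c (\<alpha> ` e) = c' (\<alpha> ` e)"
  have "e \<in> (\<Union>i\<in>{1..d}. P i)" using P e by (simp add: cf_partitions_iff)
  then obtain i where "i \<in> {1..d}" "e \<in> P i" by blast
  then show "coincide_at d P Q e"
    using representsD[OF P(2), of i e] representsD[OF Q, of i e] eq by (auto simp: coincide_at_def)
qed

end

lemma represents_unique:
  assumes "P \<in> cf_partitions d" "Q \<in> cf_partitions d" "represents d \<alpha> \<beta> P c" "represents d \<alpha> \<beta> Q c'"
    and "\<And>e. e \<in> edges {1..2 * d} \<Longrightarrow> c (\<alpha> ` e) = c' (\<alpha> ` e)"
  shows "P = Q"
proof (rule extensionalityI[of _ "{1..d}"])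
  show "P i = Q i" if "i \<in> {1..d}" for i
    using that assms(3-5) by (auto simp: represents_def)
qed (use assms(1,2) in \<open>simp_all add: cf_partitions_iff\<close>)

section \<open>Involutions as flips of colourings\<close>

text \<open>By \<open>cf_colouring_flip\<close> only \<open>P\<close> and one other cycle-free
  partition have the given values off the triangle, so being different from \<open>P\<close> already
  forces two differing edges.\<close>

lemma involution_eqI:
  assumes P: "P \<in> cf_partitions d" and Q: "Q \<in> cf_partitions d" "P \<noteq> Q"
    and V: "{x, y, z} \<subseteq> {1..2 * d}" "distinct [x, y, z]"
    and off: "\<forall>e \<in> edges {1..2 * d} - {{x, y}, {x, z}, {y, z}}. coincide_at d P Q e"
  shows "involution d P x y z = Q"
proof -
  have id: "bij_betw id {1..2 * d} {1..2 * d}" "bij_betw id {1..d} {1..d}" by simp_all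
  define T where "T = {{x, y}, {x, z}, {y, z}}"
  have T: "T \<subseteq> edges {1..2 * d}" using V by (simp add: T_def)
  have finT: "finite T" by (simp add: T_def)
  note off = off[folded T_def]
  obtain p where p: "represents d id id P p" using represents_exists_colouring[OF id P] ..
  note pcf = represents_cf_colouring[OF id P p]
  have xyz: "x \<in> {1..2 * d}" "y \<in> {1..2 * d}" "z \<in> {1..2 * d}" "x \<noteq> y" "x \<noteq> z" "y \<noteq> z"
    using V by simp_all
  obtain q where q: "cf_colouring {1..2 * d} {1..d} q" "\<forall>e \<in> edges {1..2 * d} - T. p e = q e"
    "p {x, y} \<noteq> q {x, y} \<and> p {x, z} \<noteq> q {x, z} \<or> p {x, y} \<noteq> q {x, y} \<and> p {y, z} \<noteq> q {y, z}
      \<or> p {x, z} \<noteq> q {x, z} \<and> p {y, z} \<noteq> q {y, z}"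
    "\<forall>b. cf_colouring {1..2 * d} {1..d} b \<longrightarrow> (\<forall>e \<in> edges {1..2 * d} - T. p e = b e)
      \<longrightarrow> (\<forall>e\<in>edges {1..2 * d}. b e = p e) \<or> (\<forall>e\<in>edges {1..2 * d}. b e = q e)"
    using cf_colouring_flip[OF pcf xyz, folded T_def] .
  \<comment> \<open>Every competitor \<open>R\<close> other than \<open>P\<close> is represented by
    the same flipped colouring \<open>q\<close>, which also yields uniqueness.\<close>
  have only: "represents d id id R q" if R: "R \<in> cf_partitions d" "R \<noteq> P"
    "\<forall>e \<in> edges {1..2 * d} - T. coincide_at d P R e" for R
  proof -
    obtain r where r: "represents d id id R r" using represents_exists_colouring[OF id R(1)] ..
    have "\<forall>e \<in> edges {1..2 * d} - T. p e = r e"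
      using R(3) represents_coincide_iff[OF id P p r] by simp
    then consider "\<forall>e\<in>edges {1..2 * d}. r e = p e" | "\<forall>e\<in>edges {1..2 * d}. r e = q e"
      using q(4) represents_cf_colouring[OF id R(1) r] by blast
    then show ?thesis
    proof cases
      case 1
      then have "R = P" using represents_unique[OF R(1) P r p] by simp
      then show ?thesis using R(2) by simp
    next
      case 2
      then show ?thesis using r by (auto simp: represents_def)
    qed
  qed
  note Qq = only[OF Q(1) Q(2)[symmetric] off]
  show ?thesis
    unfolding involution_def complete_edges_eq T_def[symmetric]
  proof (rule the_equality)
    have dis: "{x, y} \<noteq> {x, z}" "{x, y} \<noteq> {y, z}" "{x, z} \<noteq> {y, z}"
      using xyz by (auto simp: doubleton_eq_iff)
    have "{e \<in> T. \<not> coincide_at d P Q e} = {e \<in> T. p e \<noteq> q e}"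
      using represents_coincide_iff[OF id P p Qq] subsetD[OF T] by (auto simp del: image_id)
    moreover have "\<exists>S \<subseteq> {e \<in> T. p e \<noteq> q e}. card S = 2"
      using q(3)
    proof (elim disjE)
      assume "p {x, y} \<noteq> q {x, y} \<and> p {x, z} \<noteq> q {x, z}"
      then show ?thesis using dis by (intro exI[of _ "{{x, y}, {x, z}}"]) (simp add: T_def)
    next
      assume "p {x, y} \<noteq> q {x, y} \<and> p {y, z} \<noteq> q {y, z}"
      then show ?thesis using dis by (intro exI[of _ "{{x, y}, {y, z}}"]) (simp add: T_def)
    next
      assume "p {x, z} \<noteq> q {x, z} \<and> p {y, z} \<noteq> q {y, z}"
      then show ?thesis using dis by (intro exI[of _ "{{x, z}, {y, z}}"]) (simp add: T_def)
    qed
    ultimately obtain S where "S \<subseteq> {e \<in> T. \<not> coincide_at d P Q e}" "card S = 2" by auto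
    then have "card {e \<in> T. \<not> coincide_at d P Q e} \<ge> 2"
      using card_mono[of "{e \<in> T. \<not> coincide_at d P Q e}" S] finT by simp
    with Q(1) off show "Q \<in> cf_partitions d \<and> (\<forall>e \<in> edges {1..2 * d} - T. coincide_at d P Q e)
        \<and> card {e \<in> T. \<not> coincide_at d P Q e} \<ge> 2"
      by (intro conjI)
  next
    fix R
    assume R: "R \<in> cf_partitions d \<and> (\<forall>e \<in> edges {1..2 * d} - T. coincide_at d P R e)
        \<and> card {e \<in> T. \<not> coincide_at d P R e} \<ge> 2"
    have "R \<noteq> P"
    proof
      assume "R = P"
      then have "{e \<in> T. \<not> coincide_at d P R e} = {}"
        using represents_coincide_iff[OF id P p p] subsetD[OF T] by auto
      with R have "2 \<le> card ({} :: nat set set)" by metis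
      then show False by simp
    qed
    then have "represents d id id R q" using only R by blast
    then show "R = Q" using represents_unique[OF _ Q(1) _ Qq] R by simp
  qed
qed

text \<open>The flipped colouring is translated back into a partition, which
  \<open>involution_eqI\<close> identifies with the value of \<open>involution\<close>.\<close>

lemma involution_in_cf_partitions:
  assumes P: "P \<in> cf_partitions d" and V: "{x, y, z} \<subseteq> {1..2 * d}" "distinct [x, y, z]"
  shows "involution d P x y z \<in> cf_partitions d"
    "\<forall>e \<in> edges {1..2 * d} - {{x, y}, {x, z}, {y, z}}. coincide_at d P (involution d P x y z) e"
proof -
  have id: "bij_betw id {1..2 * d} {1..2 * d}" "bij_betw id {1..d} {1..d}" by simp_all
  obtain p where p: "represents d id id P p" using represents_exists_colouring[OF id P] ..
  have xyz: "x \<in> {1..2 * d}" "y \<in> {1..2 * d}" "z \<in> {1..2 * d}" "x \<noteq> y" "x \<noteq> z" "y \<noteq> z"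
    using V by simp_all
  obtain q where q: "cf_colouring {1..2 * d} {1..d} q"
    "\<forall>e \<in> edges {1..2 * d} - {{x, y}, {x, z}, {y, z}}. p e = q e"
    "p {x, y} \<noteq> q {x, y} \<or> p {x, z} \<noteq> q {x, z}"
    using cf_colouring_flip[OF represents_cf_colouring[OF id P p] xyz] by (metis (no_types))
  obtain Q where Q: "Q \<in> cf_partitions d" "represents d id id Q q"
    using represents_exists_partition[OF id q(1)] ..
  have off: "\<forall>e \<in> edges {1..2 * d} - {{x, y}, {x, z}, {y, z}}. coincide_at d P Q e"
    using q(2) represents_coincide_iff[OF id P p Q(2)] by simp
  have "P \<noteq> Q"
  proof
    assume "P = Q"
    then have "represents d id id P q" using Q(2) by simp
    then have "p e = q e" if "e \<in> edges {1..2 * d}" for e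
      using represents_coincide_iff[OF id P p _ that] represents_coincide_iff[OF id P p p that] by simp
    then show False using q(3) xyz by simp
  qed
  from involution_eqI[OF P Q(1) this V off] Q(1) off
  show "involution d P x y z \<in> cf_partitions d"
    "\<forall>e \<in> edges {1..2 * d} - {{x, y}, {x, z}, {y, z}}. coincide_at d P (involution d P x y z) e"
    by simp_all
qed

text \<open>The involution leads from \<open>Q\<close> back to \<open>P\<close>, the direction in
  which \<open>involution_equivalent\<close> writes its chains. The corners of a flip come
  unordered; sorting them does not change the triangle.\<close>

lemma flip_step_imp_involution:
  assumes P: "P \<in> cf_partitions d" "represents d id id P c" and Q: "Q \<in> cf_partitions d" "represents d id id Q c'"
    and step: "flip_step {1..2 * d} {1..d} c c'" and ne: "P \<noteq> Q"
  shows "\<exists>x y z. 1 \<le> x \<and> x < y \<and> y < z \<and> z \<le> 2 * d \<and> involution d Q x y z = P"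
proof -
  have id: "bij_betw id {1..2 * d} {1..2 * d}" "bij_betw id {1..d} {1..d}" by simp_all
  have "\<not> (\<forall>e\<in>edges {1..2 * d}. c e = c' e)"
    using ne represents_unique[OF P(1) Q(1) P(2) Q(2)] by auto
  then obtain x y z where xyz: "x \<in> {1..2 * d}" "y \<in> {1..2 * d}" "z \<in> {1..2 * d}" "x \<noteq> y" "x \<noteq> z" "y \<noteq> z"
    and off: "\<forall>e \<in> edges {1..2 * d} - {{x, y}, {x, z}, {y, z}}. c e = c' e"
    using step unfolding flip_step_def by metis
  have inv: "involution d Q u v w = P"
    if "u \<in> {x, y, z}" "v \<in> {x, y, z}" "w \<in> {x, y, z}" "u < v" "v < w" for u v w
  proof (rule involution_eqI[OF Q(1) P(1) ne[symmetric]])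
    show "{u, v, w} \<subseteq> {1..2 * d}" "distinct [u, v, w]"
      using that xyz by auto
    have "{{u, v}, {u, w}, {v, w}} = {{x, y}, {x, z}, {y, z}}"
      using that xyz(4-6) by (elim insertE emptyE) (simp_all add: insert_commute)
    then show "\<forall>e \<in> edges {1..2 * d} - {{u, v}, {u, w}, {v, w}}. coincide_at d Q P e"
      using off represents_coincide_iff[OF id Q P(2)] by simp
  qed
  have "\<exists>u\<in>{x, y, z}. \<exists>v\<in>{x, y, z}. \<exists>w\<in>{x, y, z}. u < v \<and> v < w"
    using xyz(4-6) by (simp; linarith)
  then obtain u v w where uvw: "u \<in> {x, y, z}" "v \<in> {x, y, z}" "w \<in> {x, y, z}" "u < v" "v < w"
    by blast
  have "1 \<le> u" "w \<le> 2 * d" using uvw(1,3) xyz(1-3) by auto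
  with inv[OF uvw] uvw(4,5) show ?thesis by blast
qed

lemma involution_equivalent_refl: "P \<in> cf_partitions d \<Longrightarrow> involution_equivalent d P P"
  unfolding involution_equivalent_def by (intro exI[of _ "0 :: nat"] exI[of _ "\<lambda>_. P"]) simp

lemma involution_equivalent_step:
  assumes "involution_equivalent d P Q" "Q' \<in> cf_partitions d"
    and xyz: "1 \<le> x" "x < y" "y < z" "z \<le> 2 * d" "involution d Q' x y z = Q"
  shows "involution_equivalent d P Q'"
proof -
  obtain n :: nat and R X Y Z where "R 0 = P \<and> R n = Q \<and> (\<forall>i\<in>{0..n}. R i \<in> cf_partitions d)
    \<and> (\<forall>i\<in>{1..n}. 1 \<le> X i \<and> X i < Y i \<and> Y i < Z i \<and> Z i \<le> 2 * d
       \<and> involution d (R i) (X i) (Y i) (Z i) = R (i - 1))"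
    using assms(1) unfolding involution_equivalent_def by (elim exE) (erule that)
  then have R: "R 0 = P" "R n = Q" "\<forall>i\<in>{0..n}. R i \<in> cf_partitions d"
    "\<forall>i\<in>{1..n}. 1 \<le> X i \<and> X i < Y i \<and> Y i < Z i \<and> Z i \<le> 2 * d
       \<and> involution d (R i) (X i) (Y i) (Z i) = R (i - 1)"
    by simp_all
  let ?R = "R(Suc n := Q')" and ?X = "X(Suc n := x)" and ?Y = "Y(Suc n := y)" and ?Z = "Z(Suc n := z)"
  have "\<forall>i\<in>{0..Suc n}. ?R i \<in> cf_partitions d"
    using R(3) assms(2) by auto
  moreover have "1 \<le> ?X i \<and> ?X i < ?Y i \<and> ?Y i < ?Z i \<and> ?Z i \<le> 2 * d
       \<and> involution d (?R i) (?X i) (?Y i) (?Z i) = ?R (i - 1)" if "i \<in> {1..Suc n}" for i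
  proof (cases "i = Suc n")
    case True
    then show ?thesis using R(2) xyz by simp
  next
    case False
    then have "i \<in> {1..n}" using that by auto
    then show ?thesis using R(4) by auto
  qed
  moreover have "?R 0 = P" "?R (Suc n) = Q'" using R(1) by simp_all
  ultimately show ?thesis
    unfolding involution_equivalent_def
    by (intro exI[of _ "Suc n"] exI[of _ ?R] exI[of _ ?X] exI[of _ ?Y] exI[of _ ?Z]) blast
qed

text \<open>Each intermediate colouring is turned back into a partition, and steps that leave the
  partition unchanged are dropped.\<close>

lemma flip_equiv_imp_involution_equivalent:
  assumes P: "P \<in> cf_partitions d" "represents d id id P c" and Q: "Q \<in> cf_partitions d" "represents d id id Q c'"
    and "flip_equiv {1..2 * d} {1..d} c c'"
  shows "involution_equivalent d P Q"
  using assms(5) Q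
proof (induction arbitrary: Q rule: rtranclp_induct)
  case base
  have "P = Q" using represents_unique[OF P(1) base(1) P(2) base(2)] by simp
  then show ?case using involution_equivalent_refl[OF P(1)] by simp
next
  case (step b c')
  have id: "bij_betw id {1..2 * d} {1..2 * d}" "bij_betw id {1..d} {1..d}" by simp_all
  obtain R where R: "R \<in> cf_partitions d" "represents d id id R b"
    using represents_exists_partition[OF id flip_step_cf(1)[OF step.hyps(2)]] ..
  note PR = step.IH[OF R]
  show ?case
  proof (cases "R = Q")
    case False
    then obtain x y z where "1 \<le> x" "x < y" "y < z" "z \<le> 2 * d" "involution d Q x y z = R"
      using flip_step_imp_involution[OF R step.prems step.hyps(2)] by metis
    from involution_equivalent_step[OF PR step.prems(1) this] show ?thesis .
  qed (use PR in simp)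
qed

section \<open>Weak equivalence and the twin-star hypothesis\<close>

text \<open>The action only renames vertices and parts, so it can be moved into the labellings. Part
  \<open>k\<close> becomes part \<open>\<tau> k\<close>, because \<open>index_act\<close> uses the
  inverse of \<open>\<tau>\<close>.\<close>

lemma represents_act:
  assumes \<sigma>: "\<sigma> permutes {1..2 * d}" and \<tau>: "\<tau> permutes {1..d}" and \<Gamma>: "\<Gamma> \<in> cf_partitions d"
    and r: "represents d \<alpha> \<beta> (vertex_act d \<sigma> (index_act d \<tau> \<Gamma>)) c"
  shows "represents d (\<alpha> \<circ> \<sigma>) (\<beta> \<circ> \<tau>) \<Gamma> c"
  unfolding represents_def
proof (intro ballI set_eqI)
  fix k e assume k: "k \<in> {1..d}"
  have inj: "inj \<sigma>" using \<sigma> by (rule permutes_inj)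
  have \<tau>k: "\<tau> k \<in> {1..d}" using permutes_in_image[OF \<tau>] k by simp
  have sub: "\<Gamma> k \<subseteq> edges {1..2 * d}" using \<Gamma> k by (simp add: cf_partitions_iff)
  have "vertex_act d \<sigma> (index_act d \<tau> \<Gamma>) (\<tau> k) = {{\<sigma> u, \<sigma> v} | u v. {u, v} \<in> \<Gamma> k}"
    using \<tau>k permutes_inverses(2)[OF \<tau>] by (simp add: vertex_act_def index_act_def)
  also have "\<dots> = (`) \<sigma> ` \<Gamma> k"
  proof (intro set_eqI iffI)
    fix f assume "f \<in> {{\<sigma> u, \<sigma> v} | u v. {u, v} \<in> \<Gamma> k}"
    then obtain u v where "f = \<sigma> ` {u, v}" "{u, v} \<in> \<Gamma> k" by auto
    then show "f \<in> (`) \<sigma> ` \<Gamma> k" by blast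
  next
    fix f assume "f \<in> (`) \<sigma> ` \<Gamma> k"
    then obtain g where g: "g \<in> \<Gamma> k" "f = \<sigma> ` g" by blast
    then obtain u v where "g = {u, v}" using sub by (meson edgesE subsetD)
    then show "f \<in> {{\<sigma> u, \<sigma> v} | u v. {u, v} \<in> \<Gamma> k}" using g by auto
  qed
  finally have "e \<in> \<Gamma> k \<longleftrightarrow> \<sigma> ` e \<in> vertex_act d \<sigma> (index_act d \<tau> \<Gamma>) (\<tau> k)"
    by (simp add: image_iff inj_image_eq_iff[OF inj])
  also have "\<dots> \<longleftrightarrow> \<sigma> ` e \<in> edges {1..2 * d} \<and> c (\<alpha> ` \<sigma> ` e) = \<beta> (\<tau> k)"
    by (rule representsD[OF r \<tau>k])
  also have "\<sigma> ` e \<in> edges {1..2 * d} \<longleftrightarrow> e \<in> edges {1..2 * d}"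
  proof
    assume "\<sigma> ` e \<in> edges {1..2 * d}"
    then obtain e' where "e' \<in> edges {1..2 * d}" "\<sigma> ` e = \<sigma> ` e'"
      using edges_image[OF permutes_imp_bij[OF \<sigma>]] by blast
    then show "e \<in> edges {1..2 * d}" by (simp add: inj_image_eq_iff[OF inj])
  next
    assume "e \<in> edges {1..2 * d}"
    then show "\<sigma> ` e \<in> edges {1..2 * d}"
      using edges_image[OF permutes_imp_bij[OF \<sigma>]] by blast
  qed
  finally show "e \<in> \<Gamma> k \<longleftrightarrow> e \<in> {e \<in> edges {1..2 * d}. c ((\<alpha> \<circ> \<sigma>) ` e) = (\<beta> \<circ> \<tau>) k}"
    by (simp add: image_comp)
qed

text \<open>Group elements alter only the labellings, so along a weak equivalence the colouring
  itself moves by flips. The final labellings are uncontrolled, which is harmless because a twin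
  star of any colour and with any centres is good enough.\<close>

lemma weakly_equivalent_flip_equiv:
  assumes "weakly_equivalent d P Q" and "bij_betw \<alpha> {1..2 * d} V" "bij_betw \<beta> {1..d} C" "represents d \<alpha> \<beta> P c"
  obtains \<alpha>' \<beta>' c' where "bij_betw \<alpha>' {1..2 * d} V" "bij_betw \<beta>' {1..d} C" "represents d \<alpha>' \<beta>' Q c'"
    "flip_equiv V C c c'"
proof -
  obtain n :: nat and R x y z \<sigma> \<tau> where "R 0 = P \<and> R n = Q \<and> (\<forall>i\<in>{0..n}. R i \<in> cf_partitions d)
    \<and> (\<forall>i\<in>{1..n}. 1 \<le> x i \<and> x i < y i \<and> y i < z i \<and> z i \<le> 2 * d
        \<and> \<sigma> i permutes {1..2 * d} \<and> \<tau> i permutes {1..d}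
        \<and> vertex_act d (\<sigma> i) (index_act d (\<tau> i) (involution d (R i) (x i) (y i) (z i))) = R (i - 1))"
    using assms(1) unfolding weakly_equivalent_def by (elim exE) (erule that)
  then have R0: "R 0 = P" "R n = Q" and cf: "\<forall>i\<in>{0..n}. R i \<in> cf_partitions d"
    and R: "\<forall>i\<in>{1..n}. 1 \<le> x i \<and> x i < y i \<and> y i < z i \<and> z i \<le> 2 * d
        \<and> \<sigma> i permutes {1..2 * d} \<and> \<tau> i permutes {1..d}
        \<and> vertex_act d (\<sigma> i) (index_act d (\<tau> i) (involution d (R i) (x i) (y i) (z i))) = R (i - 1)"
    by simp_all
  have "\<exists>\<alpha>' \<beta>' c'. bij_betw \<alpha>' {1..2 * d} V \<and> bij_betw \<beta>' {1..d} C \<and> represents d \<alpha>' \<beta>' (R k) c'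
      \<and> flip_equiv V C c c'" if "k \<le> n" for k
    using that
  proof (induction k)
    case 0
    show ?case using assms(2-4) R0(1) by blast
  next
    case (Suc k)
    then obtain \<alpha>' \<beta>' b where \<alpha>': "bij_betw \<alpha>' {1..2 * d} V" and \<beta>': "bij_betw \<beta>' {1..d} C"
      and b: "represents d \<alpha>' \<beta>' (R k) b" "flip_equiv V C c b"
      by auto
    let ?x = "x (Suc k)" and ?y = "y (Suc k)" and ?z = "z (Suc k)" and ?s = "\<sigma> (Suc k)" and ?t = "\<tau> (Suc k)"
    define I where "I = involution d (R (Suc k)) ?x ?y ?z"
    have *: "1 \<le> ?x" "?x < ?y" "?y < ?z" "?z \<le> 2 * d" "?s permutes {1..2 * d}" "?t permutes {1..d}"
      "vertex_act d ?s (index_act d ?t I) = R k"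
      using R[rule_format, of "Suc k"] Suc.prems by (simp_all add: I_def)
    have cf': "R (Suc k) \<in> cf_partitions d" using cf Suc.prems by simp
    have tri: "{?x, ?y, ?z} \<subseteq> {1..2 * d}" "distinct [?x, ?y, ?z]" using *(1-4) by auto
    note I = involution_in_cf_partitions[OF cf' tri, folded I_def]
    have \<alpha>'': "bij_betw (\<alpha>' \<circ> ?s) {1..2 * d} V"
      using permutes_imp_bij[OF *(5)] \<alpha>' by (rule bij_betw_trans)
    have \<beta>'': "bij_betw (\<beta>' \<circ> ?t) {1..d} C"
      using permutes_imp_bij[OF *(6)] \<beta>' by (rule bij_betw_trans)
    \<comment> \<open>\<open>b\<close> is kept: under the new labellings it represents the flipped
      partition \<open>I\<close>, and only the involution remains to be performed.\<close>
    have rI: "represents d (\<alpha>' \<circ> ?s) (\<beta>' \<circ> ?t) I b"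
      using represents_act[OF *(5,6) I(1)] b(1) *(7) by simp
    obtain c' where c': "represents d (\<alpha>' \<circ> ?s) (\<beta>' \<circ> ?t) (R (Suc k)) c'"
      using represents_exists_colouring[OF \<alpha>'' \<beta>'' cf'] ..
    let ?a = "\<alpha>' \<circ> ?s"
    have inj: "inj_on ?a {1..2 * d}" using \<alpha>'' by (rule bij_betw_imp_inj_on)
    have mem: "?x \<in> {1..2 * d}" "?y \<in> {1..2 * d}" "?z \<in> {1..2 * d}" using tri by simp_all
    have "flip_equiv V C b c'"
    proof (rule flip_equivI)
      show "cf_colouring V C b" by (rule represents_cf_colouring[OF \<alpha>'' \<beta>'' I(1) rI])
      show "cf_colouring V C c'" by (rule represents_cf_colouring[OF \<alpha>'' \<beta>'' cf' c'])
      show "?a ?x \<in> V" "?a ?y \<in> V" "?a ?z \<in> V"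
        using bij_betwE[OF \<alpha>''] mem by blast+
      show "?a ?x \<noteq> ?a ?y" "?a ?x \<noteq> ?a ?z" "?a ?y \<noteq> ?a ?z"
        using inj_on_eq_iff[OF inj] mem *(2,3) by simp_all
      fix e assume e: "e \<in> edges V" "e \<noteq> {?a ?x, ?a ?y}" "e \<noteq> {?a ?x, ?a ?z}" "e \<noteq> {?a ?y, ?a ?z}"
      then obtain e' where e': "e' \<in> edges {1..2 * d}" "e = ?a ` e'"
        using edges_image[OF \<alpha>''] by blast
      have "e' \<noteq> {?x, ?y}" "e' \<noteq> {?x, ?z}" "e' \<noteq> {?y, ?z}"
        using e(2-4) unfolding e'(2) by (metis image_empty image_insert)+
      then have "coincide_at d (R (Suc k)) I e'"
        using I(2) e'(1) by simp
      then show "b e = c' e"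
        using represents_coincide_iff[OF \<alpha>'' \<beta>'' cf' c' rI e'(1)] e'(2) by simp
    qed
    with b(2) have "flip_equiv V C c c'" by (rule rtranclp_trans)
    with \<alpha>'' \<beta>'' c' show ?case by blast
  qed
  from this[of n] show thesis using that R0(2) by auto
qed

lemma twin_star_hypothesis_flip_equiv:
  fixes V :: "'v set" and C :: "'c set"
  assumes ts: "twin_star_hypothesis (card C)" and C: "card C \<ge> 1" and c: "cf_colouring V C c"
  shows "\<exists>c' j a b A B. flip_equiv V C c c' \<and> twin_star_at V C c' j a b A B"
proof -
  define d where "d = card C"
  note D = cf_colouringD[OF c]
  obtain \<alpha> where \<alpha>: "bij_betw \<alpha> {1..2 * d} V"
    using ex_bij_betw_nat_finite_1[OF D(1)] D(3) d_def by auto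
  obtain \<beta> where \<beta>: "bij_betw \<beta> {1..d} C"
    using ex_bij_betw_nat_finite_1[OF D(2)] d_def by auto
  obtain P where P: "P \<in> cf_partitions d" "represents d \<alpha> \<beta> P c"
    using represents_exists_partition[OF \<alpha> \<beta> c] ..
  obtain \<Gamma> j where \<Gamma>: "\<Gamma> \<in> cf_partitions d" "weakly_equivalent d P \<Gamma>" and j: "j \<in> {1..d}"
    and iso: "graph_isomorphic {1..2 * d} (\<Gamma> j) {1..2 * d} (twin_star d)"
    using ts P(1) unfolding twin_star_hypothesis_def d_def[symmetric] by blast
  obtain \<alpha>' \<beta>' c' where \<alpha>': "bij_betw \<alpha>' {1..2 * d} V" and \<beta>': "bij_betw \<beta>' {1..d} C"
    and c': "represents d \<alpha>' \<beta>' \<Gamma> c'" and eqv: "flip_equiv V C c c'"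
    using weakly_equivalent_flip_equiv[OF \<Gamma>(2) \<alpha> \<beta> P(2)] .
  obtain f where f: "bij_betw f {1..2 * d} {1..2 * d}"
    and fE: "\<And>u v. u \<in> {1..2 * d} \<Longrightarrow> v \<in> {1..2 * d} \<Longrightarrow> {u, v} \<in> \<Gamma> j \<longleftrightarrow> {f u, f v} \<in> twin_star d"
    using iso unfolding graph_isomorphic_def by blast
  define g where "g = inv_into {1..2 * d} f"
  have g: "bij_betw g {1..2 * d} {1..2 * d}" unfolding g_def using f by (rule bij_betw_inv_into)
  \<comment> \<open>Names the vertices of \<open>V\<close> after those of the standard twin star, so
    that 1 and 2 give the centres.\<close>
  define \<gamma> where "\<gamma> = \<alpha>' \<circ> g"
  have \<gamma>: "bij_betw \<gamma> {1..2 * d} V" unfolding \<gamma>_def using g \<alpha>' by (rule bij_betw_trans)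
  have edge: "c' {\<gamma> p, \<gamma> q} = \<beta>' j" if "p \<in> {1..2 * d}" "q \<in> {1..2 * d}" "{p, q} \<in> twin_star d" for p q
  proof -
    have "{g p, g q} \<in> \<Gamma> j"
      using fE[of "g p" "g q"] that bij_betwE[OF g] bij_betw_inv_into_right[OF f] by (simp add: g_def)
    then have "c' (\<alpha>' ` {g p, g q}) = \<beta>' j"
      using representsD[OF c' j] by blast
    then show ?thesis by (simp add: \<gamma>_def)
  qed
  \<comment> \<open>The odd labels above 1 are the leaves of 1, the even labels above 2 those of
    2.\<close>
  define K where "K = (\<lambda>k. 2 * k + 1) ` {1..d - 1}"
  define L where "L = (\<lambda>k. 2 * k + 2) ` {1..d - 1}"
  have "d \<ge> 1" using C by (simp add: d_def)
  have split: "{1..2 * d} = insert 1 (insert 2 (K \<union> L))"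
  proof (intro set_eqI iffI)
    fix m assume m: "m \<in> {1..2 * d}"
    show "m \<in> insert 1 (insert 2 (K \<union> L))"
    proof (cases "m \<le> 2")
      case False
      show ?thesis
      proof (cases "even m")
        case True
        then obtain k where "m = 2 * k" by (elim evenE)
        then have "m = 2 * (k - 1) + 2" "k - 1 \<in> {1..d - 1}" using m False by auto
        then show ?thesis unfolding L_def by blast
      next
        case odd: False
        then obtain k where "m = 2 * k + 1" by (elim oddE)
        then have "m = 2 * k + 1" "k \<in> {1..d - 1}" using m False by auto
        then show ?thesis unfolding K_def by blast
      qed
    qed (use m in auto)
  next
    fix m assume "m \<in> insert 1 (insert 2 (K \<union> L))"
    then show "m \<in> {1..2 * d}" using \<open>d \<ge> 1\<close> by (auto simp: K_def L_def)
  qed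
  have KL: "K \<inter> L = {}" "1 \<notin> K" "1 \<notin> L" "2 \<notin> K" "2 \<notin> L"
    by (auto simp: K_def L_def) presburger+
  have sub: "1 \<in> {1..2 * d}" "2 \<in> {1..2 * d}" "K \<subseteq> {1..2 * d}" "L \<subseteq> {1..2 * d}"
    unfolding split by auto
  note inj = bij_betw_imp_inj_on[OF \<gamma>]
  have "twin_star_at V C c' (\<beta>' j) (\<gamma> 1) (\<gamma> 2) (\<gamma> ` K) (\<gamma> ` L)"
  proof (rule twin_star_atI)
    show "cf_colouring V C c'" by (rule represents_cf_colouring[OF \<alpha>' \<beta>' \<Gamma>(1) c'])
    show "\<beta>' j \<in> C" using bij_betwE[OF \<beta>'] j by blast
    have "V = \<gamma> ` {1..2 * d}" using bij_betw_imp_surj_on[OF \<gamma>] by simp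
    then show "V = insert (\<gamma> 1) (insert (\<gamma> 2) (\<gamma> ` K \<union> \<gamma> ` L))"
      unfolding split by (simp add: image_Un)
    show "\<gamma> 1 \<noteq> \<gamma> 2" using inj_on_eq_iff[OF inj sub(1,2)] by simp
    show "\<gamma> 1 \<notin> \<gamma> ` K \<union> \<gamma> ` L" "\<gamma> 2 \<notin> \<gamma> ` K \<union> \<gamma> ` L"
      using inj_on_image_mem_iff[OF inj sub(1)] inj_on_image_mem_iff[OF inj sub(2)] sub(3,4) KL(2-5)
      by simp_all
    show "\<gamma> ` K \<inter> \<gamma> ` L = {}"
      using inj_on_image_Int[OF inj sub(3,4)] KL(1) by simp
    have "card K = d - 1" "card L = d - 1"
      unfolding K_def L_def by (simp_all add: card_image inj_on_def)
    then show "card (\<gamma> ` K) = card (\<gamma> ` L)"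
      using card_image[OF inj_on_subset[OF inj sub(3)]] card_image[OF inj_on_subset[OF inj sub(4)]] by simp
    show "c' {\<gamma> 1, \<gamma> 2} = \<beta>' j"
      using sub by (intro edge) (simp_all add: twin_star_def)
    show "c' {\<gamma> 1, u} = \<beta>' j" if u: "u \<in> \<gamma> ` K" for u
    proof -
      obtain k where k: "k \<in> {1..d - 1}" "u = \<gamma> (2 * k + 1)" using u by (auto simp: K_def)
      have "2 * k + 1 \<in> {1..2 * d}" using sub(3) k(1) by (auto simp: K_def)
      moreover have "{1, 2 * k + 1} \<in> twin_star d" using k(1) by (auto simp: twin_star_def)
      ultimately show ?thesis unfolding k(2) using sub(1) by (intro edge)
    qed
    show "c' {\<gamma> 2, u} = \<beta>' j" if u: "u \<in> \<gamma> ` L" for u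
    proof -
      obtain k where k: "k \<in> {1..d - 1}" "u = \<gamma> (2 * k + 2)" using u by (auto simp: L_def)
      have "2 * k + 2 \<in> {1..2 * d}" using sub(4) k(1) by (auto simp: L_def)
      moreover have "{2, 2 * k + 2} \<in> twin_star d" using k(1) by (auto simp: twin_star_def)
      ultimately show ?thesis unfolding k(2) using sub(2) by (intro edge)
    qed
  qed
  with eqv show ?thesis by blast
qed

theorem theorem3p6:
  fixes d :: nat
  assumes "d \<ge> 1"
    and "\<forall>i\<in>{1..d}. twin_star_hypothesis i"
  shows "\<forall>P \<in> cf_partitions d. \<forall>Q \<in> cf_partitions d. involution_equivalent d P Q"
proof (intro ballI)
  fix P Q assume P: "P \<in> cf_partitions d" and Q: "Q \<in> cf_partitions d"
  have id: "bij_betw id {1..2 * d} {1..2 * d}" "bij_betw id {1..d} {1..d}" by simp_all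
  obtain p q where p: "represents d id id P p" and q: "represents d id id Q q"
    using represents_exists_colouring[OF id P] represents_exists_colouring[OF id Q] by blast
  have "flip_equiv {1..2 * d} {1..d} p q"
  \<comment> \<open>The induction meets colour sets of every size up to \<open>d\<close>, which is
    why the hypothesis is assumed for all these sizes.\<close>
  proof (rule cf_colourings_flip_equiv[of d])
    show "\<exists>c' j a b A B. flip_equiv V C c c' \<and> twin_star_at V C c' j a b A B"
      if "card C \<le> d" "card C \<ge> 1" "cf_colouring V C c" for V :: "nat set" and C :: "nat set" and c
      using assms(2) that by (intro twin_star_hypothesis_flip_equiv) auto
  qed (use represents_cf_colouring[OF id P p] represents_cf_colouring[OF id Q q] in simp_all)
  then show "involution_equivalent d P Q"
    by (rule flip_equiv_imp_involution_equivalent[OF P p Q q])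
qed

end
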